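(* Suppose that $G$ and $H$ are locally compact, locally Hausdorff, étale groupoids with $G^{(0)}$ paracompact, and that $Z$ is a $(G,H)$-equivalence. There is a net $\{e_\lambda\}_{\lambda\in\Lambda}$ in $\mathcal C(G)$ that is an approximate identity with respect to the inductive limit topology for the left action of $\mathcal C(G)$ on $\mathcal C(Z)$ and for the right action of $\mathcal C(G)$ on $\mathcal C(Z^{op})$ (i.e. $e_\lambda\cdot\phi\to\phi$ for all $\phi\in\mathcal C(Z)$ and $\psi\cdot e_\lambda\to\psi$ for all $\psi\in\mathcal C(Z^{op})$), where each $e_\lambda$ is a finite sum of elements of the form ${}_G\langle\phi_i^\lambda,\widetilde{\phi_i^\lambda}\rangle$ with $\phi_i^\lambda\in\mathcal C(Z)$.
   Context: Groupoids have locally compact Hausdorff unit space. For a locally compact, locally Hausdorff space $X$, $\mathcal C(X)=\mathrm{span}\{f\in C_c(U):U\subseteq X\text{ open Hausdorff}\}$ (extension by zero). A net $f_i\in\mathcal C(X)$ converges to $f\in\mathcal C(X)$ in the inductive limit topology if there are a compact set $K\subseteq X$ (independent of $i$) and $i_0$ such that $f_i\to f$ uniformly and $f_i$ vanishes outside $K$ for all $i\ge i_0$. A left $G$-space is a locally compact, locally Hausdorff space $Z$ with a continuous open anchor map $r_Z:Z\to G^{(0)}$ and a continuous action $(\gamma,z)\mapsto\gamma\cdot z$ defined when $s(\gamma)=r_Z(z)$; it is free if $\gamma z=z$ implies $\gamma=r_Z(z)$, and proper if $(\gamma,z)\mapsto(\gamma z,z)$ is a proper map into $Z\times Z$ (closed,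 with compact inverse images of compact sets). Right spaces have anchor $s_Z$. A $(G,H)$-equivalence is a free and proper left $G$-space and free and proper right $H$-space $Z$ with commuting actions such that $r_Z$ induces a homeomorphism $Z/H\to G^{(0)}$ and $s_Z$ induces a homeomorphism $G\backslash Z\to H^{(0)}$ ($Z$ Hausdorff if $G$ and $H$ are). $Z^{op}=\{\bar z:z\in Z\}$ is a homeomorphic copy of $Z$. For $\phi\in\mathcal C(Z)$, $\widetilde\phi\in\mathcal C(Z^{op})$ is $\widetilde\phi(\bar z)=\phi(z)$. For $a\in\mathcal C(G)$, $\phi\in\mathcal C(Z)$, $\psi\in\mathcal C(Z^{op})$: $$(a\cdot\phi)(z)=\sum_{r(\gamma)=r_Z(z)}a(\gamma)\phi(\gamma^{-1}z),\qquad(\psi\cdot a)(\bar z)=\sum_{r(\gamma)=r_Z(z)}\psi(\overline{\gamma^{-1}z})a(\gamma^{-1}),$$ $${}_G\langle\phi,\psi\rangle(\gamma)=\sum_{\eta\in H,\ r(\eta)=s_Z(z)}\phi(z\eta)\,\psi(\overline{\gamma^{-1}z\eta})\quad\text{for any }z\in Z\text{ with }r_Z(z)=r(\gamma).$$ *)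

theory Defs
  imports "HOL-Analysis.Analysis"
begin

section \<open>Topological preliminaries\<close>

text \<open>Outside the Hausdorff setting local compactness is taken in its strong form: every point has
  a neighbourhood base of compact sets.  Compactness never includes the Hausdorff axiom.\<close>

definition lc_lH_space :: "'a topology \<Rightarrow> bool" where
  "lc_lH_space X \<longleftrightarrow>
     neighbourhood_base_of (compactin X) X \<and>
     (\<forall>x\<in>topspace X. \<exists>U. openin X U \<and> x \<in> U \<and> Hausdorff_space (subtopology X U))"

definition paracompact_space :: "'a topology \<Rightarrow> bool" where
  "paracompact_space X \<longleftrightarrow>
     (\<forall>\<U>. (\<forall>U\<in>\<U>. openin X U) \<and> \<Union>\<U> = topspace X \<longrightarrow>
        (\<exists>\<V>. (\<forall>V\<in>\<V>. openin X V) \<and> \<Union>\<V> = topspace X \<and>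
             (\<forall>V\<in>\<V>. \<exists>U\<in>\<U>. V \<subseteq> U) \<and> locally_finite_in X \<V>))"

definition local_homeomorphism :: "'a topology \<Rightarrow> 'b topology \<Rightarrow> ('a \<Rightarrow> 'b) \<Rightarrow> bool" where
  "local_homeomorphism X Y f \<longleftrightarrow>
     (\<forall>x\<in>topspace X. \<exists>U. openin X U \<and> x \<in> U \<and> openin Y (f ` U) \<and>
        homeomorphic_map (subtopology X U) (subtopology Y (f ` U)) f)"

definition quotient_topology :: "'a topology \<Rightarrow> ('a \<Rightarrow> 'b) \<Rightarrow> 'b topology" where
  "quotient_topology X q =
     topology (\<lambda>V. V \<subseteq> q ` topspace X \<and> openin X {x \<in> topspace X. q x \<in> V})"

lemma openin_quotient_topology:
  "openin (quotient_topology X q) V \<longleftrightarrow>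
     V \<subseteq> q ` topspace X \<and> openin X {x \<in> topspace X. q x \<in> V}"
proof -
  have "istopology (\<lambda>V. V \<subseteq> q ` topspace X \<and> openin X {x \<in> topspace X. q x \<in> V})"
  proof -
    have "openin X {x \<in> topspace X. q x \<in> S \<inter> T}"
      if "openin X {x \<in> topspace X. q x \<in> S}" "openin X {x \<in> topspace X. q x \<in> T}" for S T
    proof -
      have "{x \<in> topspace X. q x \<in> S \<inter> T} =
            {x \<in> topspace X. q x \<in> S} \<inter> {x \<in> topspace X. q x \<in> T}" by auto
      then show ?thesis using openin_Int[OF that] by simp
    qed
    moreover have "openin X {x \<in> topspace X. q x \<in> \<Union>\<K>}"
      if "\<forall>K\<in>\<K>. openin X {x \<in> topspace X. q x \<in> K}" for \<K>
    proof -
      have "{x \<in> topspace X. q x \<in> \<Union>\<K>} = (\<Union>K\<in>\<K>. {x \<in> topspace X. q x \<in> K})" by auto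
      moreover have "openin X (\<Union>K\<in>\<K>. {x \<in> topspace X. q x \<in> K})"
        by (rule openin_Union) (use that in auto)
      ultimately show ?thesis by simp
    qed
    ultimately show ?thesis by (simp add: istopology_def le_infI1 Sup_le_iff)
  qed
  then show ?thesis by (simp add: quotient_topology_def)
qed

lemma topspace_quotient_topology: "topspace (quotient_topology X q) = q ` topspace X"
proof
  show "topspace (quotient_topology X q) \<subseteq> q ` topspace X"
    using openin_topspace[of "quotient_topology X q"] unfolding openin_quotient_topology by simp
  have "{x \<in> topspace X. q x \<in> q ` topspace X} = topspace X" by auto
  then have "openin (quotient_topology X q) (q ` topspace X)"
    unfolding openin_quotient_topology by simp
  then show "q ` topspace X \<subseteq> topspace (quotient_topology X q)"
    by (rule openin_subset)
qed

text \<open>\<open>f\<close> factors through the quotient of \<open>X\<close> by \<open>q\<close>, and the induced map is a homeomorphism.\<close>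

definition induces_homeomorphism ::
    "'a topology \<Rightarrow> ('a \<Rightarrow> 'b) \<Rightarrow> 'c topology \<Rightarrow> ('a \<Rightarrow> 'c) \<Rightarrow> bool" where
  "induces_homeomorphism X q Y f \<longleftrightarrow>
     (\<exists>h. homeomorphic_map (quotient_topology X q) Y h \<and> (\<forall>x\<in>topspace X. h (q x) = f x))"

section \<open>The function space and its inductive limit topology\<close>

text \<open>Complex functions on \<open>X\<close> are total functions vanishing off \<open>topspace X\<close>; an element of
  \<open>C_c U X\<close> is a compactly supported continuous function on \<open>U\<close>, extended by zero.\<close>

definition C_c :: "'a set \<Rightarrow> 'a topology \<Rightarrow> ('a \<Rightarrow> complex) set" where
  "C_c U X = {f. continuous_map (subtopology X U) euclidean f \<and>
                 compactin (subtopology X U) (subtopology X U closure_of {x \<in> U. f x \<noteq> 0}) \<and>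
                 (\<forall>x. x \<notin> U \<longrightarrow> f x = 0)}"

definition C_span :: "'a topology \<Rightarrow> ('a \<Rightarrow> complex) set" where
  "C_span X = {f. \<exists>(n::nat) c g.
       (\<forall>i<n. \<exists>U. openin X U \<and> Hausdorff_space (subtopology X U) \<and> g i \<in> C_c U X) \<and>
       f = (\<lambda>x. \<Sum>i<n. c i * g i x)}"

text \<open>A net is a function on a directed preordered index set \<open>\<Lambda>\<close>.\<close>

definition directed_set :: "'i set \<Rightarrow> ('i \<Rightarrow> 'i \<Rightarrow> bool) \<Rightarrow> bool" where
  "directed_set \<Lambda> le \<longleftrightarrow> \<Lambda> \<noteq> {} \<and> reflp_on \<Lambda> le \<and> transp_on \<Lambda> le \<and>
     (\<forall>i\<in>\<Lambda>. \<forall>j\<in>\<Lambda>. \<exists>k\<in>\<Lambda>. le i k \<and> le j k)"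

definition inductive_limit_converges ::
    "'x topology \<Rightarrow> 'i set \<Rightarrow> ('i \<Rightarrow> 'i \<Rightarrow> bool) \<Rightarrow> ('i \<Rightarrow> 'x \<Rightarrow> complex) \<Rightarrow> ('x \<Rightarrow> complex) \<Rightarrow> bool" where
  "inductive_limit_converges X \<Lambda> le f \<phi> \<longleftrightarrow>
     (\<forall>i\<in>\<Lambda>. f i \<in> C_span X) \<and> \<phi> \<in> C_span X \<and>
     (\<exists>K. compactin X K \<and> (\<exists>i\<^sub>0\<in>\<Lambda>. \<forall>i\<in>\<Lambda>. le i\<^sub>0 i \<longrightarrow> (\<forall>x. x \<notin> K \<longrightarrow> f i x = 0))) \<and>
     (\<forall>\<epsilon>>0. \<exists>i\<^sub>1\<in>\<Lambda>. \<forall>i\<in>\<Lambda>. le i\<^sub>1 i \<longrightarrow> (\<forall>x\<in>topspace X. cmod (f i x - \<phi> x) < \<epsilon>))"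

text \<open>Every net \<open>e\<close>, with indices of any type, can be replaced by one indexed by pairs (value, tail
  of values) without losing convergence of anything computed from \<open>e\<close>.  Hence the existence of a
  net of functions \<open>'a \<Rightarrow> complex\<close> can be expressed with indices of the type
  \<open>('a \<Rightarrow> complex) \<times> ('a \<Rightarrow> complex) set\<close> and no loss of generality.\<close>

lemma net_reindexing:
  fixes e :: "'i \<Rightarrow> 'e"
  assumes d: "directed_set \<Lambda> le"
  defines "\<Lambda>' \<equiv> (\<lambda>i. (e i, e ` {j \<in> \<Lambda>. le i j})) ` \<Lambda>"
    and "le' \<equiv> (\<lambda>p q. snd q \<subseteq> snd p)"
  shows "directed_set \<Lambda>' le'"
    and "fst ` \<Lambda>' = e ` \<Lambda>"
    and "\<And>X F \<phi>. inductive_limit_converges X \<Lambda> le (\<lambda>i. F (e i)) \<phi> \<Longrightarrow>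
                   inductive_limit_converges X \<Lambda>' le' (\<lambda>p. F (fst p)) \<phi>"
proof -
  have ne: "\<Lambda> \<noteq> {}" and rf: "\<And>i. i \<in> \<Lambda> \<Longrightarrow> le i i"
    and tr: "\<And>i j k. \<lbrakk>i \<in> \<Lambda>; j \<in> \<Lambda>; k \<in> \<Lambda>; le i j; le j k\<rbrakk> \<Longrightarrow> le i k"
    and up: "\<And>i j. \<lbrakk>i \<in> \<Lambda>; j \<in> \<Lambda>\<rbrakk> \<Longrightarrow> \<exists>k\<in>\<Lambda>. le i k \<and> le j k"
  proof -
    show "\<Lambda> \<noteq> {}" using d by (simp add: directed_set_def)
    show "le i i" if "i \<in> \<Lambda>" for i
      using d that by (auto simp: directed_set_def dest: reflp_onD)
    show "le i k" if "i \<in> \<Lambda>" "j \<in> \<Lambda>" "k \<in> \<Lambda>" "le i j" "le j k" for i j k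
      using d that transp_onD[of \<Lambda> le i j k] by (simp add: directed_set_def)
    show "\<exists>k\<in>\<Lambda>. le i k \<and> le j k" if "i \<in> \<Lambda>" "j \<in> \<Lambda>" for i j
      using d that by (simp add: directed_set_def)
  qed
  show "fst ` \<Lambda>' = e ` \<Lambda>" by (auto simp: \<Lambda>'_def image_image)
  show "directed_set \<Lambda>' le'"
    unfolding directed_set_def
  proof (intro conjI ballI)
    show "\<Lambda>' \<noteq> {}" using ne by (simp add: \<Lambda>'_def)
    show "reflp_on \<Lambda>' le'" by (rule reflp_onI) (simp add: le'_def)
    show "transp_on \<Lambda>' le'"
      by (rule transp_onI) (unfold le'_def, rule subset_trans)
    fix p q assume "p \<in> \<Lambda>'" "q \<in> \<Lambda>'"
    then obtain i j where ij: "i \<in> \<Lambda>" "p = (e i, e ` {j \<in> \<Lambda>. le i j})"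
        "j \<in> \<Lambda>" "q = (e j, e ` {k \<in> \<Lambda>. le j k})"
      by (auto simp: \<Lambda>'_def)
    obtain k where k: "k \<in> \<Lambda>" "le i k" "le j k" using up ij by blast
    have "(e k, e ` {j \<in> \<Lambda>. le k j}) \<in> \<Lambda>'" unfolding \<Lambda>'_def using k(1) by (rule imageI)
    moreover have "{l \<in> \<Lambda>. le k l} \<subseteq> {l \<in> \<Lambda>. le i l}" "{l \<in> \<Lambda>. le k l} \<subseteq> {l \<in> \<Lambda>. le j l}"
      using ij(1,3) k tr by blast+
    then have "le' p (e k, e ` {j \<in> \<Lambda>. le k j})" "le' q (e k, e ` {j \<in> \<Lambda>. le k j})"
      unfolding ij(2,4) le'_def snd_conv by (simp_all only: image_mono)
    ultimately show "\<exists>r\<in>\<Lambda>'. le' p r \<and> le' q r" by blast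
  qed
  have tail: "\<exists>k\<in>\<Lambda>. le i k \<and> fst p = e k"
    if t: "i \<in> \<Lambda>" "p \<in> \<Lambda>'" "le' (e i, e ` {j \<in> \<Lambda>. le i j}) p" for i p
  proof -
    obtain j where j: "j \<in> \<Lambda>" "p = (e j, e ` {k \<in> \<Lambda>. le j k})"
      using t by (auto simp: \<Lambda>'_def)
    have "e j \<in> e ` {k \<in> \<Lambda>. le j k}" using j rf by blast
    then have "e j \<in> e ` {k \<in> \<Lambda>. le i k}" using t j by (auto simp: le'_def)
    then show ?thesis using j by auto
  qed
  have ev: "\<exists>p\<in>\<Lambda>'. \<forall>q\<in>\<Lambda>'. le' p q \<longrightarrow> P (fst q)"
    if t: "\<exists>i\<in>\<Lambda>. \<forall>j\<in>\<Lambda>. le i j \<longrightarrow> P (e j)" for P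
  proof -
    obtain i where i: "i \<in> \<Lambda>" "\<forall>j\<in>\<Lambda>. le i j \<longrightarrow> P (e j)" using t by blast
    let ?p = "(e i, e ` {j \<in> \<Lambda>. le i j})"
    have "?p \<in> \<Lambda>'" unfolding \<Lambda>'_def using i(1) by (rule imageI)
    moreover have "P (fst q)" if q: "q \<in> \<Lambda>'" "le' ?p q" for q
    proof -
      obtain k where "k \<in> \<Lambda>" "le i k" "fst q = e k" using tail[OF i(1) q] by blast
      then show ?thesis using i(2) by simp
    qed
    ultimately show ?thesis by blast
  qed
  show "inductive_limit_converges X \<Lambda>' le' (\<lambda>p. F (fst p)) \<phi>"
    if c: "inductive_limit_converges X \<Lambda> le (\<lambda>i. F (e i)) \<phi>" for X F \<phi>
    unfolding inductive_limit_converges_def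
  proof (intro conjI ballI allI impI)
    show "F (fst p) \<in> C_span X" if "p \<in> \<Lambda>'" for p
      using c that by (auto simp: inductive_limit_converges_def \<Lambda>'_def)
    show "\<phi> \<in> C_span X" using c by (simp add: inductive_limit_converges_def)
    obtain K where K: "compactin X K" "\<exists>i\<in>\<Lambda>. \<forall>j\<in>\<Lambda>. le i j \<longrightarrow> (\<forall>x. x \<notin> K \<longrightarrow> F (e j) x = 0)"
      using c unfolding inductive_limit_converges_def by blast
    show "\<exists>K. compactin X K \<and>
        (\<exists>p\<in>\<Lambda>'. \<forall>q\<in>\<Lambda>'. le' p q \<longrightarrow> (\<forall>x. x \<notin> K \<longrightarrow> F (fst q) x = 0))"
      using K(1) ev[OF K(2)] by blast
    fix \<epsilon> :: real assume "0 < \<epsilon>"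
    then have "\<exists>i\<in>\<Lambda>. \<forall>j\<in>\<Lambda>. le i j \<longrightarrow> (\<forall>x\<in>topspace X. cmod (F (e j) x - \<phi> x) < \<epsilon>)"
      using c unfolding inductive_limit_converges_def by blast
    from ev[OF this]
    show "\<exists>p\<in>\<Lambda>'. \<forall>q\<in>\<Lambda>'. le' p q \<longrightarrow> (\<forall>x\<in>topspace X. cmod (F (fst q) x - \<phi> x) < \<epsilon>)" .
  qed
qed

section \<open>Groupoids\<close>

text \<open>Arrows form \<open>topspace (gtop G)\<close>; units are identified with their identity arrows, and
  \<open>gmult G \<gamma> \<eta>\<close> is meaningful when \<open>src G \<gamma> = rng G \<eta>\<close>.\<close>

record 'g groupoid =
  gtop :: "'g topology"
  rng :: "'g \<Rightarrow> 'g"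
  src :: "'g \<Rightarrow> 'g"
  gmult :: "'g \<Rightarrow> 'g \<Rightarrow> 'g"
  ginv :: "'g \<Rightarrow> 'g"

abbreviation arrows :: "'g groupoid \<Rightarrow> 'g set" where
  "arrows G \<equiv> topspace (gtop G)"

definition unit_space :: "'g groupoid \<Rightarrow> 'g topology" where
  "unit_space G = subtopology (gtop G) (rng G ` arrows G)"

definition algebraic_groupoid :: "'g groupoid \<Rightarrow> bool" where
  "algebraic_groupoid G \<longleftrightarrow>
     (\<forall>\<gamma>\<in>arrows G. rng G \<gamma> \<in> arrows G \<and> src G \<gamma> \<in> arrows G \<and> ginv G \<gamma> \<in> arrows G \<and>
        rng G (rng G \<gamma>) = rng G \<gamma> \<and> src G (rng G \<gamma>) = rng G \<gamma> \<and>
        rng G (src G \<gamma>) = src G \<gamma> \<and> src G (src G \<gamma>) = src G \<gamma> \<and>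
        gmult G (rng G \<gamma>) \<gamma> = \<gamma> \<and> gmult G \<gamma> (src G \<gamma>) = \<gamma> \<and>
        rng G (ginv G \<gamma>) = src G \<gamma> \<and> src G (ginv G \<gamma>) = rng G \<gamma> \<and>
        gmult G \<gamma> (ginv G \<gamma>) = rng G \<gamma> \<and> gmult G (ginv G \<gamma>) \<gamma> = src G \<gamma>) \<and>
     (\<forall>\<gamma>\<in>arrows G. \<forall>\<eta>\<in>arrows G. src G \<gamma> = rng G \<eta> \<longrightarrow>
        gmult G \<gamma> \<eta> \<in> arrows G \<and>
        rng G (gmult G \<gamma> \<eta>) = rng G \<gamma> \<and> src G (gmult G \<gamma> \<eta>) = src G \<eta>) \<and>
     (\<forall>\<gamma>\<in>arrows G. \<forall>\<eta>\<in>arrows G. \<forall>\<zeta>\<in>arrows G.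
        src G \<gamma> = rng G \<eta> \<and> src G \<eta> = rng G \<zeta> \<longrightarrow>
        gmult G (gmult G \<gamma> \<eta>) \<zeta> = gmult G \<gamma> (gmult G \<eta> \<zeta>))"

text \<open>Continuity of \<open>rng\<close> and \<open>src\<close> follows from that of inversion and multiplication.  The unit
  space is Hausdorff by convention.\<close>

definition lc_lH_groupoid :: "'g groupoid \<Rightarrow> bool" where
  "lc_lH_groupoid G \<longleftrightarrow>
     algebraic_groupoid G \<and>
     continuous_map (gtop G) (gtop G) (ginv G) \<and>
     continuous_map
       (subtopology (prod_topology (gtop G) (gtop G)) {(\<gamma>, \<eta>). src G \<gamma> = rng G \<eta>})
       (gtop G) (\<lambda>(\<gamma>, \<eta>). gmult G \<gamma> \<eta>) \<and>
     lc_lH_space (gtop G) \<and>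
     locally_compact_space (unit_space G) \<and> Hausdorff_space (unit_space G)"

definition etale :: "'g groupoid \<Rightarrow> bool" where
  "etale G \<longleftrightarrow> local_homeomorphism (gtop G) (unit_space G) (rng G) \<and>
               local_homeomorphism (gtop G) (unit_space G) (src G)"

section \<open>Groupoid spaces and equivalences\<close>

text \<open>\<open>proper_map\<close> does not include continuity, but that holds for the maps below; by
  \<open>proper_map_alt\<close> it means: closed, with compact inverse images of compact sets.\<close>

definition left_space ::
    "'g groupoid \<Rightarrow> 'z topology \<Rightarrow> ('z \<Rightarrow> 'g) \<Rightarrow> ('g \<Rightarrow> 'z \<Rightarrow> 'z) \<Rightarrow> bool" where
  "left_space G X \<rho> act \<longleftrightarrow>
     lc_lH_space X \<and>
     continuous_map X (unit_space G) \<rho> \<and> open_map X (unit_space G) \<rho> \<and>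
     continuous_map (subtopology (prod_topology (gtop G) X) {(\<gamma>, z). src G \<gamma> = \<rho> z})
       X (\<lambda>(\<gamma>, z). act \<gamma> z) \<and>
     (\<forall>z\<in>topspace X. act (\<rho> z) z = z) \<and>
     (\<forall>\<gamma>\<in>arrows G. \<forall>z\<in>topspace X. src G \<gamma> = \<rho> z \<longrightarrow> \<rho> (act \<gamma> z) = rng G \<gamma>) \<and>
     (\<forall>\<gamma>\<in>arrows G. \<forall>\<eta>\<in>arrows G. \<forall>z\<in>topspace X. src G \<gamma> = rng G \<eta> \<and> src G \<eta> = \<rho> z \<longrightarrow>
        act (gmult G \<gamma> \<eta>) z = act \<gamma> (act \<eta> z))"

definition left_free ::
    "'g groupoid \<Rightarrow> 'z topology \<Rightarrow> ('z \<Rightarrow> 'g) \<Rightarrow> ('g \<Rightarrow> 'z \<Rightarrow> 'z) \<Rightarrow> bool" where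
  "left_free G X \<rho> act \<longleftrightarrow>
     (\<forall>\<gamma>\<in>arrows G. \<forall>z\<in>topspace X. src G \<gamma> = \<rho> z \<and> act \<gamma> z = z \<longrightarrow> \<gamma> = \<rho> z)"

definition left_proper ::
    "'g groupoid \<Rightarrow> 'z topology \<Rightarrow> ('z \<Rightarrow> 'g) \<Rightarrow> ('g \<Rightarrow> 'z \<Rightarrow> 'z) \<Rightarrow> bool" where
  "left_proper G X \<rho> act \<longleftrightarrow>
     proper_map (subtopology (prod_topology (gtop G) X) {(\<gamma>, z). src G \<gamma> = \<rho> z})
       (prod_topology X X) (\<lambda>(\<gamma>, z). (act \<gamma> z, z))"

definition right_space ::
    "'h groupoid \<Rightarrow> 'z topology \<Rightarrow> ('z \<Rightarrow> 'h) \<Rightarrow> ('z \<Rightarrow> 'h \<Rightarrow> 'z) \<Rightarrow> bool" where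
  "right_space H X \<sigma> act \<longleftrightarrow>
     lc_lH_space X \<and>
     continuous_map X (unit_space H) \<sigma> \<and> open_map X (unit_space H) \<sigma> \<and>
     continuous_map (subtopology (prod_topology X (gtop H)) {(z, \<eta>). \<sigma> z = rng H \<eta>})
       X (\<lambda>(z, \<eta>). act z \<eta>) \<and>
     (\<forall>z\<in>topspace X. act z (\<sigma> z) = z) \<and>
     (\<forall>\<eta>\<in>arrows H. \<forall>z\<in>topspace X. \<sigma> z = rng H \<eta> \<longrightarrow> \<sigma> (act z \<eta>) = src H \<eta>) \<and>
     (\<forall>\<eta>\<in>arrows H. \<forall>\<zeta>\<in>arrows H. \<forall>z\<in>topspace X. \<sigma> z = rng H \<eta> \<and> src H \<eta> = rng H \<zeta> \<longrightarrow>
        act z (gmult H \<eta> \<zeta>) = act (act z \<eta>) \<zeta>)"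

definition right_free ::
    "'h groupoid \<Rightarrow> 'z topology \<Rightarrow> ('z \<Rightarrow> 'h) \<Rightarrow> ('z \<Rightarrow> 'h \<Rightarrow> 'z) \<Rightarrow> bool" where
  "right_free H X \<sigma> act \<longleftrightarrow>
     (\<forall>\<eta>\<in>arrows H. \<forall>z\<in>topspace X. \<sigma> z = rng H \<eta> \<and> act z \<eta> = z \<longrightarrow> \<eta> = \<sigma> z)"

definition right_proper ::
    "'h groupoid \<Rightarrow> 'z topology \<Rightarrow> ('z \<Rightarrow> 'h) \<Rightarrow> ('z \<Rightarrow> 'h \<Rightarrow> 'z) \<Rightarrow> bool" where
  "right_proper H X \<sigma> act \<longleftrightarrow>
     proper_map (subtopology (prod_topology X (gtop H)) {(z, \<eta>). \<sigma> z = rng H \<eta>})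
       (prod_topology X X) (\<lambda>(z, \<eta>). (z, act z \<eta>))"

record ('g, 'h, 'z) bispace =
  ztop :: "'z topology"
  r_anchor :: "'z \<Rightarrow> 'g"
  s_anchor :: "'z \<Rightarrow> 'h"
  lact :: "'g \<Rightarrow> 'z \<Rightarrow> 'z"
  ract :: "'z \<Rightarrow> 'h \<Rightarrow> 'z"

definition left_orbit :: "'g groupoid \<Rightarrow> ('g, 'h, 'z) bispace \<Rightarrow> 'z \<Rightarrow> 'z set" where
  "left_orbit G Z z = {lact Z \<gamma> z | \<gamma>. \<gamma> \<in> arrows G \<and> src G \<gamma> = r_anchor Z z}"

definition right_orbit :: "'h groupoid \<Rightarrow> ('g, 'h, 'z) bispace \<Rightarrow> 'z \<Rightarrow> 'z set" where
  "right_orbit H Z z = {ract Z z \<eta> | \<eta>. \<eta> \<in> arrows H \<and> s_anchor Z z = rng H \<eta>}"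

definition groupoid_equivalence ::
    "'g groupoid \<Rightarrow> 'h groupoid \<Rightarrow> ('g, 'h, 'z) bispace \<Rightarrow> bool" where
  "groupoid_equivalence G H Z \<longleftrightarrow>
     left_space G (ztop Z) (r_anchor Z) (lact Z) \<and>
     left_free G (ztop Z) (r_anchor Z) (lact Z) \<and>
     left_proper G (ztop Z) (r_anchor Z) (lact Z) \<and>
     right_space H (ztop Z) (s_anchor Z) (ract Z) \<and>
     right_free H (ztop Z) (s_anchor Z) (ract Z) \<and>
     right_proper H (ztop Z) (s_anchor Z) (ract Z) \<and>
     (\<forall>\<gamma>\<in>arrows G. \<forall>z\<in>topspace (ztop Z). src G \<gamma> = r_anchor Z z \<longrightarrow>
        s_anchor Z (lact Z \<gamma> z) = s_anchor Z z) \<and>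
     (\<forall>\<eta>\<in>arrows H. \<forall>z\<in>topspace (ztop Z). s_anchor Z z = rng H \<eta> \<longrightarrow>
        r_anchor Z (ract Z z \<eta>) = r_anchor Z z) \<and>
     (\<forall>\<gamma>\<in>arrows G. \<forall>\<eta>\<in>arrows H. \<forall>z\<in>topspace (ztop Z).
        src G \<gamma> = r_anchor Z z \<and> s_anchor Z z = rng H \<eta> \<longrightarrow>
        ract Z (lact Z \<gamma> z) \<eta> = lact Z \<gamma> (ract Z z \<eta>)) \<and>
     induces_homeomorphism (ztop Z) (right_orbit H Z) (unit_space G) (r_anchor Z) \<and>
     induces_homeomorphism (ztop Z) (left_orbit G Z) (unit_space H) (s_anchor Z) \<and>
     (Hausdorff_space (gtop G) \<and> Hausdorff_space (gtop H) \<longrightarrow> Hausdorff_space (ztop Z))"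

section \<open>The opposite space, the module actions and the inner product\<close>

datatype 'z opp = bar (unbar: 'z)

definition opp_top :: "'z topology \<Rightarrow> 'z opp topology" where
  "opp_top X = pullback_topology UNIV unbar X"

lemma homeomorphic_map_bar: "homeomorphic_map X (opp_top X) bar"
proof -
  have eq: "openin (opp_top X) V \<longleftrightarrow> openin X (bar -` V)" for V
  proof
    assume "openin (opp_top X) V"
    then obtain U where U: "openin X U" "V = unbar -` U"
      by (auto simp: opp_top_def openin_pullback_topology)
    then have "bar -` V = U" by auto
    then show "openin X (bar -` V)" using U by simp
  next
    assume a: "openin X (bar -` V)"
    have "V = unbar -` (bar -` V)" by auto
    then show "openin (opp_top X) V" using a
      by (auto simp: opp_top_def openin_pullback_topology)
  qed
  have t: "topspace (opp_top X) = bar ` topspace X"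
  proof (intro set_eqI iffI)
    fix x assume "x \<in> topspace (opp_top X)"
    then have "unbar x \<in> topspace X" by (simp add: opp_top_def topspace_pullback_topology)
    then show "x \<in> bar ` topspace X" by (metis imageI opp.collapse)
  qed (auto simp: opp_top_def topspace_pullback_topology)
  have "{x \<in> topspace X. bar x \<in> U} = bar -` U" if "U \<subseteq> topspace (opp_top X)" for U
    using that by (auto simp: t)
  then have "quotient_map X (opp_top X) bar"
    unfolding quotient_map_def using eq t by simp
  then show ?thesis by (simp add: homeomorphic_map_def inj_on_def)
qed

text \<open>The sums below have only finitely many nonzero terms, although their index sets may be
  infinite; this is why \<open>infsum\<close> is used (\<open>sum\<close> would give 0 on an infinite index set).\<close>

definition left_mod ::
    "'g groupoid \<Rightarrow> ('g, 'h, 'z) bispace \<Rightarrow> ('g \<Rightarrow> complex) \<Rightarrow> ('z \<Rightarrow> complex) \<Rightarrow> 'z \<Rightarrow> complex" where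
  "left_mod G Z a \<phi> z =
     (if z \<in> topspace (ztop Z)
      then infsum (\<lambda>\<gamma>. a \<gamma> * \<phi> (lact Z (ginv G \<gamma>) z)) {\<gamma> \<in> arrows G. rng G \<gamma> = r_anchor Z z}
      else 0)"

definition right_mod ::
    "'g groupoid \<Rightarrow> ('g, 'h, 'z) bispace \<Rightarrow> ('z opp \<Rightarrow> complex) \<Rightarrow> ('g \<Rightarrow> complex) \<Rightarrow>
     'z opp \<Rightarrow> complex" where
  "right_mod G Z \<psi> a w =
     (if unbar w \<in> topspace (ztop Z)
      then infsum (\<lambda>\<gamma>. \<psi> (bar (lact Z (ginv G \<gamma>) (unbar w))) * a (ginv G \<gamma>))
             {\<gamma> \<in> arrows G. rng G \<gamma> = r_anchor Z (unbar w)}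
      else 0)"

definition tilde :: "('z \<Rightarrow> complex) \<Rightarrow> 'z opp \<Rightarrow> complex" where
  "tilde \<phi> w = \<phi> (unbar w)"

text \<open>\<open>inner_at\<close> is the sum computed at a chosen \<open>z\<close> in the fibre over \<open>rng G \<gamma>\<close>; it does not
  depend on that choice (\<open>inner_at_independent\<close>).  There is no complex conjugation:
  \<open>bar\<close> only names points of the opposite space.\<close>

definition inner_at ::
    "'g groupoid \<Rightarrow> 'h groupoid \<Rightarrow> ('g, 'h, 'z) bispace \<Rightarrow> ('z \<Rightarrow> complex) \<Rightarrow> ('z opp \<Rightarrow> complex) \<Rightarrow>
     'g \<Rightarrow> 'z \<Rightarrow> complex" where
  "inner_at G H Z \<phi> \<psi> \<gamma> z =
     infsum (\<lambda>\<eta>. \<phi> (ract Z z \<eta>) * \<psi> (bar (lact Z (ginv G \<gamma>) (ract Z z \<eta>))))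
       {\<eta> \<in> arrows H. rng H \<eta> = s_anchor Z z}"

definition inner_G ::
    "'g groupoid \<Rightarrow> 'h groupoid \<Rightarrow> ('g, 'h, 'z) bispace \<Rightarrow> ('z \<Rightarrow> complex) \<Rightarrow> ('z opp \<Rightarrow> complex) \<Rightarrow>
     'g \<Rightarrow> complex" where
  "inner_G G H Z \<phi> \<psi> \<gamma> =
     (if \<gamma> \<in> arrows G
      then inner_at G H Z \<phi> \<psi> \<gamma> (SOME z. z \<in> topspace (ztop Z) \<and> r_anchor Z z = rng G \<gamma>)
      else 0)"

lemma inner_at_independent:
  assumes H: "algebraic_groupoid H" and E: "groupoid_equivalence G H Z"
    and z: "z \<in> topspace (ztop Z)" and z': "z' \<in> topspace (ztop Z)"
    and eq: "r_anchor Z z = r_anchor Z z'"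
  shows "inner_at G H Z \<phi> \<psi> \<gamma> z = inner_at G H Z \<phi> \<psi> \<gamma> z'"
proof -
  have R: "right_space H (ztop Z) (s_anchor Z) (ract Z)"
    and I: "induces_homeomorphism (ztop Z) (right_orbit H Z) (unit_space G) (r_anchor Z)"
    using E by (auto simp: groupoid_equivalence_def)
  obtain h where inj: "inj_on h (right_orbit H Z ` topspace (ztop Z))"
    and h: "\<And>x. x \<in> topspace (ztop Z) \<Longrightarrow> h (right_orbit H Z x) = r_anchor Z x"
    using I unfolding induces_homeomorphism_def homeomorphic_map_def topspace_quotient_topology
    by blast
  have orb: "right_orbit H Z z = right_orbit H Z z'"
    using inj_onD[OF inj, of "right_orbit H Z z" "right_orbit H Z z'"] h z z' eq by auto
  have "continuous_map (ztop Z) (unit_space H) (s_anchor Z)"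
    using R by (simp add: right_space_def)
  then have "s_anchor Z z' \<in> topspace (unit_space H)"
    using z' by (auto simp: continuous_map_def)
  then have u: "s_anchor Z z' \<in> arrows H" "rng H (s_anchor Z z') = s_anchor Z z'"
    using H by (auto simp: unit_space_def algebraic_groupoid_def)
  have "ract Z z' (s_anchor Z z') = z'" using R z' by (auto simp: right_space_def)
  then have "z' \<in> right_orbit H Z z'" using u unfolding right_orbit_def by force
  then have "z' \<in> right_orbit H Z z" by (simp only: orb)
  then obtain \<eta> where \<eta>: "\<eta> \<in> arrows H" "s_anchor Z z = rng H \<eta>" "z' = ract Z z \<eta>"
    unfolding right_orbit_def by auto
  have s: "s_anchor Z z' = src H \<eta>" using R z \<eta> by (auto simp: right_space_def)
  have act: "ract Z z (gmult H \<eta> \<zeta>) = ract Z z' \<zeta>"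
    if "\<zeta> \<in> arrows H" "rng H \<zeta> = s_anchor Z z'" for \<zeta>
    using R z \<eta> s that by (simp add: right_space_def)
  have grp: "ginv H \<eta> \<in> arrows H" "rng H (ginv H \<eta>) = src H \<eta>" "src H (ginv H \<eta>) = rng H \<eta>"
      "gmult H \<eta> (ginv H \<eta>) = rng H \<eta>" "gmult H (ginv H \<eta>) \<eta> = src H \<eta>"
      "\<And>a. a \<in> arrows H \<Longrightarrow> gmult H (rng H a) a = a"
      "\<And>a b. \<lbrakk>a \<in> arrows H; b \<in> arrows H; src H a = rng H b\<rbrakk> \<Longrightarrow>
          gmult H a b \<in> arrows H \<and> rng H (gmult H a b) = rng H a"
      "\<And>a b c. \<lbrakk>a \<in> arrows H; b \<in> arrows H; c \<in> arrows H; src H a = rng H b; src H b = rng H c\<rbrakk>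
          \<Longrightarrow> gmult H (gmult H a b) c = gmult H a (gmult H b c)"
    using H \<eta>(1) by (simp_all add: algebraic_groupoid_def)
  have bij: "bij_betw (gmult H \<eta>) {\<zeta> \<in> arrows H. rng H \<zeta> = s_anchor Z z'}
                                  {\<zeta> \<in> arrows H. rng H \<zeta> = s_anchor Z z}"
  proof (rule bij_betw_byWitness[where f' = "gmult H (ginv H \<eta>)"])
    show "\<forall>a\<in>{\<zeta> \<in> arrows H. rng H \<zeta> = s_anchor Z z'}. gmult H (ginv H \<eta>) (gmult H \<eta> a) = a"
    proof
      fix a assume "a \<in> {\<zeta> \<in> arrows H. rng H \<zeta> = s_anchor Z z'}"
      then have a: "a \<in> arrows H" "src H \<eta> = rng H a" using s by auto
      show "gmult H (ginv H \<eta>) (gmult H \<eta> a) = a"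
        using grp(8)[of "ginv H \<eta>" \<eta> a] grp(1-5) grp(6)[of a] a \<eta>(1) by simp
    qed
    show "\<forall>a\<in>{\<zeta> \<in> arrows H. rng H \<zeta> = s_anchor Z z}. gmult H \<eta> (gmult H (ginv H \<eta>) a) = a"
    proof
      fix a assume "a \<in> {\<zeta> \<in> arrows H. rng H \<zeta> = s_anchor Z z}"
      then have a: "a \<in> arrows H" "rng H \<eta> = rng H a" using \<eta>(2) by auto
      show "gmult H \<eta> (gmult H (ginv H \<eta>) a) = a"
        using grp(8)[of \<eta> "ginv H \<eta>" a] grp(1-5) grp(6)[of a] a \<eta>(1) by simp
    qed
  qed (use grp \<eta> s in auto)
  show ?thesis
    unfolding inner_at_def infsum_reindex_bij_betw[OF bij, symmetric]
    by (rule infsum_cong) (simp add: act)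
qed

end

theory Submission
  imports Defs
begin

text \<open>Since both groupoids are etale, the approximate identity can be taken to consist of functions
  supported on the unit space of \<open>G\<close>.

  The free and proper action of \<open>G\<close> on \<open>Z\<close> makes \<open>s_Z\<close> locally injective: if \<open>x\<close> and \<open>y\<close> are close
  and \<open>s_Z(x) = s_Z(y)\<close>, then \<open>y = \<gamma>x\<close>, and the properness of the action together with the openness
  of the units in \<open>G\<close> forces \<open>\<gamma>\<close> to be a unit (\<open>s_locally_injective\<close>).  By symmetry \<open>r_Z\<close> is locally
  injective.  So \<open>Z\<close> is covered by open sets \<open>V\<close> on which both anchors are injective, and on which
  \<open>r_Z\<close> is a homeomorphism onto an open subset of the unit space.

  Let \<open>\<phi>\<close> be \<open>f \<circ> r_Z\<close> on such a \<open>V\<close> and \<open>0\<close> elsewhere, where \<open>f\<close> is real with compact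
  support in \<open>r_Z(V)\<close>.  A nonzero term of the inner product of \<open>\<phi>\<close> with its copy at \<open>\<gamma>\<close> needs a
  point \<open>y\<close> with \<open>y\<close> and \<open>\<gamma>\<^sup>-\<^sup>1y\<close> both in \<open>V\<close>.  Injectivity of \<open>s_Z\<close> and freeness make \<open>\<gamma>\<close> a unit,
  and injectivity of \<open>r_Z\<close> and freeness for \<open>H\<close> leave a single term.  Hence the inner product is
  \<open>f\<^sup>2\<close> on the units and \<open>0\<close> off them (\<open>inner_lift\<close>).

  Given a compact set \<open>K\<close> of units, cover it by finitely many sets \<open>r_Z(V\<^sub>i)\<close> and choose \<open>f\<^sub>i\<close> compactly
  supported in them with \<open>\<Sum>f\<^sub>i\<^sup>2 = 1\<close> on \<open>K\<close>.  The sum of the corresponding inner products is a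
  function on the units equal to \<open>1\<close> on \<open>K\<close> (\<open>local_unit\<close>).  A function \<open>u\<close> on the units acts on
  \<open>\<C>(Z)\<close> and on \<open>\<C>(Z\<^sup>o\<^sup>p)\<close> as multiplication by \<open>u \<circ> r_Z\<close>, so as soon as \<open>K\<close> contains the image
  under \<open>r_Z\<close> of a compact set off which \<open>\<phi>\<close> vanishes, the action fixes \<open>\<phi>\<close>.  The net is indexed by
  the compact sets of units, ordered by inclusion.\<close>

section \<open>Compactly supported functions\<close>

text \<open>A superset \<open>C\<close> of the support is enough: compact subsets of the Hausdorff set \<open>U\<close> are closed
  in \<open>U\<close>, so the support is a closed subset of \<open>C\<close>.\<close>

lemma C_cI:
  assumes haus: "Hausdorff_space (subtopology X U)"
    and C: "compactin X C" "C \<subseteq> U"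
    and cont: "continuous_map (subtopology X U) euclidean f"
    and zero: "\<And>x. x \<notin> C \<Longrightarrow> f x = 0"
  shows "f \<in> C_c U X"
proof -
  have CU: "compactin (subtopology X U) C"
    using C by (simp add: compactin_subtopology)
  then have "closedin (subtopology X U) C"
    using haus compactin_imp_closedin by blast
  then have "subtopology X U closure_of {x \<in> U. f x \<noteq> 0} \<subseteq> C"
    by (intro closure_of_minimal) (use zero in auto)
  then have "compactin (subtopology X U) (subtopology X U closure_of {x \<in> U. f x \<noteq> 0})"
    using closed_compactin[OF CU] closedin_closure_of by blast
  then show ?thesis
    using cont zero C by (auto simp: C_c_def)
qed

lemma C_c_imp_C_span:
  assumes "openin X U" "Hausdorff_space (subtopology X U)" "f \<in> C_c U X"
  shows "f \<in> C_span X"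
  unfolding C_span_def
  by (rule CollectI, rule exI[of _ 1], rule exI[of _ "\<lambda>_. 1"], rule exI[of _ "\<lambda>_. f"])
     (use assms in auto)

lemma C_c_mult:
  assumes g: "g \<in> C_c U X" and U: "openin X U" and f: "continuous_map X euclidean f"
  shows "(\<lambda>x. f x * g x) \<in> C_c U X"
proof -
  let ?S = "subtopology X U"
  have cg: "continuous_map ?S euclidean g"
    and kg: "compactin ?S (?S closure_of {x \<in> U. g x \<noteq> 0})" and zg: "\<And>x. x \<notin> U \<Longrightarrow> g x = 0"
    using g by (auto simp: C_c_def)
  have "continuous_map ?S euclidean (\<lambda>x. f x * g x)"
    using cg continuous_map_from_subtopology[OF f, of U]
    by (simp add: continuous_map_atin tendsto_mult)
  moreover have "compactin ?S (?S closure_of {x \<in> U. f x * g x \<noteq> 0})"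
    by (rule closed_compactin[OF kg]) (auto intro!: closure_of_mono)
  ultimately show ?thesis using zg by (simp add: C_c_def)
qed

lemma C_spanE:
  assumes "g \<in> C_span X"
  obtains n :: nat and h c where
    "\<And>i. i < n \<Longrightarrow> \<exists>U. openin X U \<and> Hausdorff_space (subtopology X U) \<and> h i \<in> C_c U X"
    "g = (\<lambda>x. \<Sum>i<n. c i * h i x)"
  using assms unfolding C_span_def by (elim CollectE exE conjE) (rule that, auto)

text \<open>Elements of the span need not be continuous, but the summands are continuous on their own
  Hausdorff open sets, and multiplication by \<open>f\<close> respects the decomposition.\<close>

lemma C_span_mult:
  assumes g: "g \<in> C_span X" and f: "continuous_map X euclidean f"
  shows "(\<lambda>x. f x * g x) \<in> C_span X"
proof -
  obtain n :: nat and h c where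
      h: "\<And>i. i < n \<Longrightarrow> \<exists>U. openin X U \<and> Hausdorff_space (subtopology X U) \<and> h i \<in> C_c U X"
    and g_eq: "g = (\<lambda>x. \<Sum>i<n. c i * h i x)"
    by (rule C_spanE[OF g]) (rule that, auto)
  have "(\<lambda>x. f x * g x) = (\<lambda>x. \<Sum>i<n. c i * (f x * h i x))"
    unfolding g_eq by (simp add: sum_distrib_left mult.left_commute)
  moreover have "\<forall>i<n. \<exists>U. openin X U \<and> Hausdorff_space (subtopology X U) \<and> (\<lambda>x. f x * h i x) \<in> C_c U X"
    using h C_c_mult[OF _ _ f] by blast
  ultimately show ?thesis unfolding C_span_def
    by (intro CollectI exI[of _ n] exI[of _ c] exI[of _ "\<lambda>i x. f x * h i x"]) simp
qed

text \<open>Take for \<open>K\<close> the union of the supports of the finitely many summands.  The closure of the set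
  where \<open>g\<close> is nonzero would not do: it need not be compact, as \<open>K\<close> need not be closed.\<close>

lemma C_span_compact_support:
  assumes "g \<in> C_span X"
  obtains K where "compactin X K" "\<And>x. x \<notin> K \<Longrightarrow> g x = 0"
proof -
  obtain n :: nat and h c where
      h: "\<And>i. i < n \<Longrightarrow> \<exists>U. openin X U \<and> Hausdorff_space (subtopology X U) \<and> h i \<in> C_c U X"
    and g_eq: "g = (\<lambda>x. \<Sum>i<n. c i * h i x)"
    by (rule C_spanE[OF assms]) (rule that, auto)
  have "\<exists>K. compactin X K \<and> (\<forall>x. x \<notin> K \<longrightarrow> h i x = 0)" if i: "i < n" for i
  proof -
    obtain U where U: "openin X U" and hU: "h i \<in> C_c U X" using h[OF i] by blast
    let ?S = "subtopology X U"
    let ?K = "?S closure_of {x \<in> U. h i x \<noteq> 0}"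
    have K: "compactin ?S ?K" "\<And>x. x \<notin> U \<Longrightarrow> h i x = 0"
      using hU by (auto simp: C_c_def)
    have "{x \<in> U. h i x \<noteq> 0} \<subseteq> ?K"
      by (rule closure_of_subset) (use openin_subset[OF U] in auto)
    then have "\<forall>x. x \<notin> ?K \<longrightarrow> h i x = 0" using K(2) by blast
    moreover have "compactin X ?K" using K(1) compactin_subtopology by blast
    ultimately show ?thesis by blast
  qed
  then obtain K where K: "\<And>i. i < n \<Longrightarrow> compactin X (K i)" "\<And>i x. i < n \<Longrightarrow> x \<notin> K i \<Longrightarrow> h i x = 0"
    by metis
  have "compactin X (\<Union>i<n. K i)"
    by (rule compactin_Union) (use K in auto)
  moreover have "g x = 0" if "x \<notin> (\<Union>i<n. K i)" for x
    using that K(2) unfolding g_eq by (intro sum.neutral) auto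
  ultimately show thesis using that by blast
qed

section \<open>Partitions of unity by squares\<close>

text \<open>A locally compact Hausdorff space is completely regular, so a point can be separated from the
  complement of an open neighbourhood \<open>W\<close> lying in a compact subset of \<open>U\<close>.\<close>

lemma bump_function:
  assumes lc: "locally_compact_space Y" and haus: "Hausdorff_space Y"
    and U: "openin Y U" "x \<in> U"
  obtains h :: "'a \<Rightarrow> real" and C where
    "continuous_map Y euclidean h" "\<And>y. y \<in> topspace Y \<Longrightarrow> 0 \<le> h y" "0 < h x"
    "compactin Y C" "C \<subseteq> U" "\<And>y. y \<in> topspace Y - C \<Longrightarrow> h y = 0"
proof -
  have "neighbourhood_base_of (compactin Y) Y"
    using lc haus locally_compact_space_neighbourhood_base by blast
  then obtain W C where W: "openin Y W" "x \<in> W" "W \<subseteq> C" and C: "compactin Y C" "C \<subseteq> U"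
    using U unfolding neighbourhood_base_of by meson
  have "completely_regular_space Y"
    using lc haus locally_compact_regular_imp_completely_regular_space by blast
  moreover have "closedin Y (topspace Y - W)" "x \<in> topspace Y - (topspace Y - W)"
    using W openin_subset[OF W(1)] by auto
  ultimately obtain f :: "'a \<Rightarrow> real" where
    f: "continuous_map Y (top_of_set {0..1}) f" "f x = 0" "f ` (topspace Y - W) \<subseteq> {1}"
    unfolding completely_regular_space_def by meson
  have cf: "continuous_map Y euclidean f" and f1: "\<And>y. y \<in> topspace Y \<Longrightarrow> f y \<le> 1"
    using f(1) by (auto simp: continuous_map_in_subtopology Pi_iff image_subset_iff)
  show thesis
  proof
    show "continuous_map Y euclidean (\<lambda>y. 1 - f y)"
      by (intro continuous_intros cf) auto
    show "1 - f y = 0" if "y \<in> topspace Y - C" for y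
      using f(3) that W(3) by auto
  qed (use f f1 C in auto)
qed

text \<open>Squares are needed because the inner product of a function with its own copy gives a square.
  Take finitely many nonnegative bumps \<open>h\<^sub>i\<close> whose sum \<open>s\<close> is positive on \<open>K\<close>, hence at least some
  \<open>\<delta> > 0\<close> there, and put \<open>f\<^sub>i = \<surd>(h\<^sub>i / max s \<delta>)\<close>: the truncation keeps the denominator positive
  everywhere and changes nothing on \<open>K\<close>.\<close>

lemma square_partition_of_unity:
  assumes lc: "locally_compact_space Y" and haus: "Hausdorff_space Y"
    and op: "\<And>U. U \<in> \<U> \<Longrightarrow> openin Y U" and K: "compactin Y K" and cover: "K \<subseteq> \<Union>\<U>"
  obtains n :: nat and U C and f :: "nat \<Rightarrow> 'a \<Rightarrow> real" where
    "\<forall>i<n. U i \<in> \<U> \<and> compactin Y (C i) \<and> C i \<subseteq> U i"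
    "\<forall>i<n. continuous_map Y euclidean (f i) \<and> (\<forall>y \<in> topspace Y - C i. f i y = 0)"
    "\<forall>y\<in>K. (\<Sum>i<n. f i y * f i y) = 1"
proof -
  have KY: "K \<subseteq> topspace Y" using K by (rule compactin_subset_topspace)
  define P where "P x U C h \<longleftrightarrow>
      U \<in> \<U> \<and> compactin Y C \<and> C \<subseteq> U \<and> continuous_map Y euclideanreal h \<and>
      (\<forall>y \<in> topspace Y. 0 \<le> h y) \<and> 0 < h x \<and> (\<forall>y \<in> topspace Y - C. h y = 0)" for x U C h
  have "\<exists>U C h. P x U C h"
    if x: "x \<in> K" for x
  proof -
    obtain U where U: "U \<in> \<U>" "x \<in> U" using cover x by blast
    obtain h :: "'a \<Rightarrow> real" and C where
      "continuous_map Y euclidean h" "\<And>y. y \<in> topspace Y \<Longrightarrow> 0 \<le> h y" "0 < h x"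
      "compactin Y C" "C \<subseteq> U" "\<And>y. y \<in> topspace Y - C \<Longrightarrow> h y = 0"
      using bump_function[OF lc haus op[OF U(1)] U(2)] by metis
    then show ?thesis using U(1) by (intro exI[of _ U] exI[of _ C] exI[of _ h]) (simp add: P_def)
  qed
  then obtain U C h where P: "\<And>x. x \<in> K \<Longrightarrow> P x (U x) (C x) (h x)"
    by metis
  have UC: "U x \<in> \<U> \<and> compactin Y (C x) \<and> C x \<subseteq> U x" if "x \<in> K" for x
    using P[OF that] by (simp add: P_def)
  have h: "continuous_map Y euclideanreal (h x)" "y \<in> topspace Y \<Longrightarrow> 0 \<le> h x y"
    "0 < h x x" "y \<in> topspace Y - C x \<Longrightarrow> h x y = 0" if "x \<in> K" for x y
    using P[OF that] by (simp_all add: P_def)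
  define W where "W x = {y \<in> topspace Y. h x y \<in> {0<..}}" for x
  have "\<exists>\<F>. finite \<F> \<and> \<F> \<subseteq> W ` K \<and> K \<subseteq> \<Union>\<F>"
  proof -
    have "openin Y (W x)" if "x \<in> K" for x
      unfolding W_def by (rule openin_continuous_map_preimage[OF h(1)[OF that]]) auto
    moreover have "K \<subseteq> \<Union>(W ` K)" using h(3) KY by (auto simp: W_def)
    ultimately show ?thesis
      using K unfolding compactin_def by (metis (no_types, lifting) imageE)
  qed
  then obtain F where F: "finite F" "F \<subseteq> K" "K \<subseteq> \<Union>(W ` F)"
    by (metis finite_subset_image)
  obtain p where p: "bij_betw p {..<card F} F"
    using ex_bij_betw_nat_finite[OF F(1)] atLeast0LessThan by metis
  have pK: "p i \<in> K" if "i < card F" for i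
    using p that F(2) by (auto simp: bij_betw_def)
  define s where "s y = (\<Sum>i<card F. h (p i) y)" for y
  have s_cont: "continuous_map Y euclidean s"
    unfolding s_def by (intro continuous_intros h(1) pK) auto
  have s_pos: "0 < s y" if y: "y \<in> K" for y
  proof -
    obtain x where x: "x \<in> F" "y \<in> W x" using F(3) y by blast
    moreover have "F = p ` {..<card F}" using p by (simp add: bij_betw_def)
    ultimately obtain i where i: "i < card F" "x = p i" by blast
    then have "0 < h (p i) y" using x by (simp add: W_def)
    show ?thesis unfolding s_def
      by (rule sum_pos2[of _ i]) (use i \<open>0 < h (p i) y\<close> h(2) pK KY y in auto)
  qed
  obtain \<delta> where \<delta>: "0 < \<delta>" "\<And>y. y \<in> K \<Longrightarrow> \<delta> \<le> s y"
  proof (cases "K = {}")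
    case False
    have "compact (s ` K)" using image_compactin[OF K s_cont] by simp
    then obtain t where "t \<in> s ` K" "\<forall>u \<in> s ` K. t \<le> u"
      using compact_attains_inf False by (metis image_is_empty)
    then show thesis using that[of t] s_pos by auto
  qed (use that[of 1] in auto)
  define f where "f i y = sqrt (h (p i) y / max (s y) \<delta>)" for i y
  have m: "max (s y) \<delta> \<noteq> 0" for y using \<delta>(1) by (simp add: max_def)
  show thesis
  proof
    show "\<forall>i<card F. U (p i) \<in> \<U> \<and> compactin Y (C (p i)) \<and> C (p i) \<subseteq> U (p i)"
      using UC pK by blast
    have "continuous_map Y euclidean (f i)" if "i < card F" for i
      unfolding f_def
      by (intro continuous_intros h(1) pK that s_cont) (rule m)
    moreover have "f i y = 0" if "i < card F" "y \<in> topspace Y - C (p i)" for i y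
      using h(4)[OF pK[OF that(1)] that(2)] by (simp add: f_def)
    ultimately show "\<forall>i<card F. continuous_map Y euclidean (f i) \<and>
        (\<forall>y \<in> topspace Y - C (p i). f i y = 0)"
      by simp
    show "\<forall>y\<in>K. (\<Sum>i<card F. f i y * f i y) = 1"
    proof
      fix y assume y: "y \<in> K"
      have sq: "f i y * f i y = h (p i) y / s y" if "i < card F" for i
        using h(2)[OF pK[OF that]] KY y \<delta>(2)[OF y] s_pos[OF y]
        by (auto simp: f_def real_sqrt_mult_self max_def)
      have "(\<Sum>i<card F. f i y * f i y) = (\<Sum>i<card F. h (p i) y / s y)"
        by (rule sum.cong) (use sq in auto)
      also have "\<dots> = 1"
        using s_pos[OF y] by (simp add: sum_divide_distrib[symmetric] s_def[symmetric])
      finally show "(\<Sum>i<card F. f i y * f i y) = 1" .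
    qed
  qed
qed

section \<open>Etale groupoids and free proper actions\<close>

lemma topspace_unit_space:
  assumes "algebraic_groupoid G"
  shows "topspace (unit_space G) = rng G ` arrows G"
proof -
  have "rng G ` arrows G \<subseteq> arrows G"
    using assms unfolding algebraic_groupoid_def by blast
  then show ?thesis by (simp add: unit_space_def inf.absorb2)
qed

lemma unit_laws:
  assumes G: "algebraic_groupoid G" and u: "u \<in> topspace (unit_space G)"
  shows "u \<in> arrows G" "rng G u = u" "src G u = u" "ginv G u = u"
proof -
  obtain \<gamma> where \<gamma>: "\<gamma> \<in> arrows G" "u = rng G \<gamma>"
    using u by (auto simp: topspace_unit_space[OF G])
  show *: "u \<in> arrows G" "rng G u = u" "src G u = u"
    using G \<gamma> unfolding algebraic_groupoid_def by metis+
  have "rng G (ginv G u) = src G u" "gmult G u (ginv G u) = rng G u" and i: "ginv G u \<in> arrows G"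
    using G *(1) unfolding algebraic_groupoid_def by blast+
  moreover have "gmult G (rng G (ginv G u)) (ginv G u) = ginv G u"
    using G i unfolding algebraic_groupoid_def by blast
  ultimately show "ginv G u = u" using * by metis
qed

text \<open>If \<open>rng G\<close> is injective on \<open>U\<close> and both \<open>\<gamma>\<close> and \<open>rng G \<gamma>\<close> lie in \<open>U\<close>, then \<open>\<gamma> = rng G \<gamma>\<close>,
  because the two have the same range.  Such \<open>\<gamma>\<close> form an open set.\<close>

lemma openin_unit_space:
  assumes G: "algebraic_groupoid G" and et: "etale G"
  shows "openin (gtop G) (topspace (unit_space G))"
proof (subst openin_subopen, intro ballI)
  fix u assume u: "u \<in> topspace (unit_space G)"
  note ul = unit_laws[OF G u]
  obtain U where U: "openin (gtop G) U" "u \<in> U"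
    and hom: "homeomorphic_map (subtopology (gtop G) U)
        (subtopology (unit_space G) (rng G ` U)) (rng G)"
    using et ul(1) unfolding etale_def local_homeomorphism_def by blast
  have UG: "U \<subseteq> arrows G" using U(1) by (rule openin_subset)
  have inj: "inj_on (rng G) U"
    using hom UG by (simp add: homeomorphic_map_def inf.absorb2)
  have "continuous_map (subtopology (gtop G) U) (gtop G) (rng G)"
    using homeomorphic_imp_continuous_map[OF hom]
    by (simp add: continuous_map_in_subtopology unit_space_def)
  then have "openin (subtopology (gtop G) U) {\<gamma> \<in> topspace (subtopology (gtop G) U). rng G \<gamma> \<in> U}"
    using U(1) by (rule openin_continuous_map_preimage)
  then have "openin (gtop G) {\<gamma> \<in> U. rng G \<gamma> \<in> U}"
    using UG U(1) by (simp add: inf.absorb2 openin_open_subtopology)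
  moreover have "{\<gamma> \<in> U. rng G \<gamma> \<in> U} \<subseteq> topspace (unit_space G)"
  proof
    fix \<gamma> assume \<gamma>: "\<gamma> \<in> {\<gamma> \<in> U. rng G \<gamma> \<in> U}"
    then have "rng G (rng G \<gamma>) = rng G \<gamma>" using G UG by (auto simp: algebraic_groupoid_def)
    then have "rng G \<gamma> = \<gamma>" using inj_onD[OF inj] \<gamma> by blast
    then show "\<gamma> \<in> topspace (unit_space G)"
      using \<gamma> UG unfolding topspace_unit_space[OF G]
      by (metis (no_types, lifting) image_eqI mem_Collect_eq subsetD)
  qed
  ultimately show "\<exists>T. openin (gtop G) T \<and> u \<in> T \<and> T \<subseteq> topspace (unit_space G)"
    using U(2) ul(2) by (intro exI[of _ "{\<gamma> \<in> U. rng G \<gamma> \<in> U}"]) auto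
qed

text \<open>Applied to the map \<open>(\<gamma>, z) \<mapsto> (\<gamma>z, z)\<close> and the set of pairs with \<open>\<gamma>\<close> not a unit, this says
  that a small enough \<open>V\<close> meets none of its translates by arrows that are not units.\<close>

lemma closed_map_avoids_square:
  assumes f: "closed_map A (prod_topology X X) f" and S: "closedin A S"
    and z: "z \<in> topspace X" "(z, z) \<notin> f ` S"
  obtains V where "openin X V" "z \<in> V" "V \<times> V \<inter> f ` S = {}"
proof -
  have "closedin (prod_topology X X) (f ` S)" using f S unfolding closed_map_def by blast
  then have op: "openin (prod_topology X X) (topspace (prod_topology X X) - f ` S)"
    by (rule openin_diff[OF openin_topspace])
  have zz: "(z, z) \<in> topspace (prod_topology X X) - f ` S" using z by simp
  obtain V1 V2 where V: "openin X V1" "openin X V2" "z \<in> V1" "z \<in> V2"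
      "V1 \<times> V2 \<subseteq> topspace (prod_topology X X) - f ` S"
    using openin_prod_topology_alt[THEN iffD1, rule_format, OF op zz] by metis
  show thesis
  proof
    show "openin X (V1 \<inter> V2)" using V by (intro openin_Int)
    show "z \<in> V1 \<inter> V2" using V by simp
    show "(V1 \<inter> V2) \<times> (V1 \<inter> V2) \<inter> f ` S = {}" using V(5) by blast
  qed
qed

text \<open>Throughout, \<open>r\<close> and \<open>s\<close> are the anchor maps of the equivalence \<open>Z\<close>, not the range and source
  of arrows.\<close>

locale etale_equivalence =
  fixes G :: "'g groupoid" and H :: "'h groupoid" and Z :: "('g, 'h, 'z) bispace"
  assumes G: "lc_lH_groupoid G" "etale G" and H: "lc_lH_groupoid H" "etale H"
    and equivalence: "groupoid_equivalence G H Z"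
begin

abbreviation "X \<equiv> ztop Z"
abbreviation "r \<equiv> r_anchor Z"
abbreviation "s \<equiv> s_anchor Z"
abbreviation "G0 \<equiv> unit_space G"
abbreviation "H0 \<equiv> unit_space H"

lemma alg: "algebraic_groupoid G" "algebraic_groupoid H"
  and G0_lc: "locally_compact_space G0" and G0_Hausdorff: "Hausdorff_space G0"
  using G H by (simp_all add: lc_lH_groupoid_def)

lemma actions:
  "left_space G X r (lact Z)" "left_free G X r (lact Z)" "left_proper G X r (lact Z)"
  "right_space H X s (ract Z)" "right_free H X s (ract Z)" "right_proper H X s (ract Z)"
  "induces_homeomorphism X (right_orbit H Z) G0 r"
  "induces_homeomorphism X (left_orbit G Z) H0 s"
  using equivalence by (simp_all add: groupoid_equivalence_def)

lemma r_continuous: "continuous_map X G0 r" and r_open: "open_map X G0 r"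
  and lact_unit: "\<And>z. z \<in> topspace X \<Longrightarrow> lact Z (r z) z = z"
  using actions(1) by (simp_all add: left_space_def)

lemma s_continuous: "continuous_map X H0 s"
  and ract_unit: "\<And>z. z \<in> topspace X \<Longrightarrow> ract Z z (s z) = z"
  using actions(4) by (simp_all add: right_space_def)

lemma r_in_units: "z \<in> topspace X \<Longrightarrow> r z \<in> topspace G0"
  using r_continuous by (auto simp: continuous_map_def)

lemma s_in_units: "z \<in> topspace X \<Longrightarrow> s z \<in> topspace H0"
  using s_continuous by (auto simp: continuous_map_def)

lemma lact_free:
  "\<lbrakk>\<gamma> \<in> arrows G; z \<in> topspace X; src G \<gamma> = r z; lact Z \<gamma> z = z\<rbrakk> \<Longrightarrow> \<gamma> = r z"
  using actions(2) unfolding left_free_def by blast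

lemma ract_free:
  "\<lbrakk>\<eta> \<in> arrows H; z \<in> topspace X; s z = rng H \<eta>; ract Z z \<eta> = z\<rbrakk> \<Longrightarrow> \<eta> = s z"
  using actions(5) unfolding right_free_def by blast

lemma s_lact:
  "\<lbrakk>\<gamma> \<in> arrows G; z \<in> topspace X; src G \<gamma> = r z\<rbrakk> \<Longrightarrow> s (lact Z \<gamma> z) = s z"
  using equivalence unfolding groupoid_equivalence_def by blast

lemma r_ract:
  "\<lbrakk>\<eta> \<in> arrows H; z \<in> topspace X; s z = rng H \<eta>\<rbrakk> \<Longrightarrow> r (ract Z z \<eta>) = r z"
  using equivalence unfolding groupoid_equivalence_def by blast

lemma ract_in_space:
  assumes "\<eta> \<in> arrows H" "z \<in> topspace X" "s z = rng H \<eta>"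
  shows "ract Z z \<eta> \<in> topspace X"
proof -
  have "continuous_map (subtopology (prod_topology X (gtop H)) {(z, \<eta>). s z = rng H \<eta>})
       X (\<lambda>(z, \<eta>). ract Z z \<eta>)"
    using actions(4) by (simp add: right_space_def)
  then have "(\<lambda>(z, \<eta>). ract Z z \<eta>) (z, \<eta>) \<in> topspace X"
    unfolding continuous_map_def Pi_iff by (rule conjunct1[THEN bspec]) (use assms in simp)
  then show ?thesis by simp
qed

lemma r_surjective:
  assumes "u \<in> topspace G0"
  obtains z where "z \<in> topspace X" "r z = u"
proof -
  obtain h where "homeomorphic_map (quotient_topology X (right_orbit H Z)) G0 h"
    and h: "\<forall>x\<in>topspace X. h (right_orbit H Z x) = r x"
    using actions(7) unfolding induces_homeomorphism_def by blast
  then have "h ` right_orbit H Z ` topspace X = topspace G0"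
    using homeomorphic_imp_surjective_map by (metis topspace_quotient_topology)
  then obtain z where "z \<in> topspace X" "h (right_orbit H Z z) = u"
    using assms by (metis (no_types, lifting) imageE)
  then show thesis using h that by simp
qed

text \<open>This is the injectivity of the map from the orbit space to the unit space of \<open>G\<close>.\<close>

lemma r_fibre_is_orbit:
  assumes z: "z \<in> topspace X" "z' \<in> topspace X" and eq: "r z = r z'"
  obtains \<eta> where "\<eta> \<in> arrows H" "s z = rng H \<eta>" "z' = ract Z z \<eta>"
proof -
  obtain h where "homeomorphic_map (quotient_topology X (right_orbit H Z)) G0 h"
    and h: "\<forall>x\<in>topspace X. h (right_orbit H Z x) = r x"
    using actions(7) unfolding induces_homeomorphism_def by blast
  then have "inj_on h (right_orbit H Z ` topspace X)"
    by (metis homeomorphic_imp_injective_map topspace_quotient_topology)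
  then have "right_orbit H Z z = right_orbit H Z z'"
    by (rule inj_onD) (use h z eq in auto)
  moreover have "z' \<in> right_orbit H Z z'"
    unfolding right_orbit_def using ract_unit[OF z(2)] unit_laws[OF alg(2) s_in_units[OF z(2)]]
    by force
  ultimately show thesis using that unfolding right_orbit_def by blast
qed

lemma s_fibre_is_orbit:
  assumes z: "z \<in> topspace X" "z' \<in> topspace X" and eq: "s z = s z'"
  obtains \<gamma> where "\<gamma> \<in> arrows G" "src G \<gamma> = r z" "z' = lact Z \<gamma> z"
proof -
  obtain h where "homeomorphic_map (quotient_topology X (left_orbit G Z)) H0 h"
    and h: "\<forall>x\<in>topspace X. h (left_orbit G Z x) = s x"
    using actions(8) unfolding induces_homeomorphism_def by blast
  then have "inj_on h (left_orbit G Z ` topspace X)"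
    by (metis homeomorphic_imp_injective_map topspace_quotient_topology)
  then have "left_orbit G Z z = left_orbit G Z z'"
    by (rule inj_onD) (use h z eq in auto)
  moreover have "z' \<in> left_orbit G Z z'"
    unfolding left_orbit_def using lact_unit[OF z(2)] unit_laws[OF alg(1) r_in_units[OF z(2)]]
    by force
  ultimately show thesis using that unfolding left_orbit_def by blast
qed

text \<open>Freeness keeps \<open>(z, z)\<close> out of the closed image of the pairs \<open>(\<gamma>, x)\<close> with \<open>\<gamma>\<close> not a unit; that
  set of pairs is closed because the units form an open subset of \<open>G\<close>.  Two points of a small
  \<open>V\<close> in the same \<open>s\<close>-fibre lie in one \<open>G\<close>-orbit and can thus only differ by a unit.\<close>

lemma s_locally_injective:
  assumes z: "z \<in> topspace X"
  obtains V where "openin X V" "z \<in> V" "inj_on s V"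
proof -
  let ?A = "subtopology (prod_topology (gtop G) X) {(\<gamma>, z). src G \<gamma> = r z}"
  let ?f = "\<lambda>(\<gamma>, z). (lact Z \<gamma> z, z)"
  define S where "S = topspace ?A - (topspace G0 \<times> topspace X) \<inter> {(\<gamma>, z). src G \<gamma> = r z}"
  have "openin ?A ((topspace G0 \<times> topspace X) \<inter> {(\<gamma>, z). src G \<gamma> = r z})"
    by (rule openin_subtopology_Int)
       (simp add: openin_prod_Times_iff openin_unit_space[OF alg(1) G(2)])
  then have S: "closedin ?A S" unfolding S_def by blast
  have "closed_map ?A (prod_topology X X) ?f"
    using actions(3) by (simp add: left_proper_def proper_imp_closed_map)
  moreover note S z
  moreover have "(z, z) \<notin> ?f ` S"
  proof
    assume "(z, z) \<in> ?f ` S"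
    then obtain \<gamma> where \<gamma>: "(\<gamma>, z) \<in> S" "lact Z \<gamma> z = z" by auto
    then have "\<gamma> \<in> arrows G" "src G \<gamma> = r z" by (auto simp: S_def)
    then have "\<gamma> = r z" using lact_free z \<gamma>(2) by blast
    then show False using \<gamma>(1) z r_in_units[OF z] by (auto simp: S_def)
  qed
  ultimately obtain V where V: "openin X V" "z \<in> V" "V \<times> V \<inter> ?f ` S = {}"
    by (rule closed_map_avoids_square)
  have "inj_on s V"
  proof (rule inj_onI)
    fix x y assume xy: "x \<in> V" "y \<in> V" "s x = s y"
    have x: "x \<in> topspace X" and y: "y \<in> topspace X" using xy openin_subset[OF V(1)] by auto
    obtain \<gamma> where \<gamma>: "\<gamma> \<in> arrows G" "src G \<gamma> = r x" "y = lact Z \<gamma> x"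
      using s_fibre_is_orbit[OF x y xy(3)] by blast
    have "(\<gamma>, x) \<notin> S" using V(3) xy \<gamma>(3) by force
    then have "\<gamma> \<in> topspace G0" using \<gamma> x by (auto simp: S_def)
    then have "\<gamma> = r x" using unit_laws(3)[OF alg(1)] \<gamma>(2) by simp
    then show "x = y" using \<gamma>(3) lact_unit[OF x] by simp
  qed
  then show thesis using that V by blast
qed

text \<open>The mirror image of \<open>s_locally_injective\<close>, with \<open>H\<close> acting from the right.\<close>

lemma r_locally_injective:
  assumes z: "z \<in> topspace X"
  obtains V where "openin X V" "z \<in> V" "inj_on r V"
proof -
  let ?A = "subtopology (prod_topology X (gtop H)) {(z, \<eta>). s z = rng H \<eta>}"
  let ?f = "\<lambda>(z, \<eta>). (z, ract Z z \<eta>)"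
  define S where "S = topspace ?A - (topspace X \<times> topspace H0) \<inter> {(z, \<eta>). s z = rng H \<eta>}"
  have "openin ?A ((topspace X \<times> topspace H0) \<inter> {(z, \<eta>). s z = rng H \<eta>})"
    by (rule openin_subtopology_Int)
       (simp add: openin_prod_Times_iff openin_unit_space[OF alg(2) H(2)])
  then have S: "closedin ?A S" unfolding S_def by blast
  have "closed_map ?A (prod_topology X X) ?f"
    using actions(6) by (simp add: right_proper_def proper_imp_closed_map)
  moreover note S z
  moreover have "(z, z) \<notin> ?f ` S"
  proof
    assume "(z, z) \<in> ?f ` S"
    then obtain \<eta> where \<eta>: "(z, \<eta>) \<in> S" "ract Z z \<eta> = z" by auto
    then have "\<eta> \<in> arrows H" "s z = rng H \<eta>" by (auto simp: S_def)
    then have "\<eta> = s z" using ract_free z \<eta>(2) by blast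
    then show False using \<eta>(1) z s_in_units[OF z] by (auto simp: S_def)
  qed
  ultimately obtain V where V: "openin X V" "z \<in> V" "V \<times> V \<inter> ?f ` S = {}"
    by (rule closed_map_avoids_square)
  have "inj_on r V"
  proof (rule inj_onI)
    fix x y assume xy: "x \<in> V" "y \<in> V" "r x = r y"
    have x: "x \<in> topspace X" and y: "y \<in> topspace X" using xy openin_subset[OF V(1)] by auto
    obtain \<eta> where \<eta>: "\<eta> \<in> arrows H" "s x = rng H \<eta>" "y = ract Z x \<eta>"
      using r_fibre_is_orbit[OF x y xy(3)] by blast
    have "(x, \<eta>) \<notin> S" using V(3) xy \<eta>(3) by force
    then have "\<eta> \<in> topspace H0" using \<eta> x by (auto simp: S_def)
    then have "\<eta> = s x" using unit_laws(2)[OF alg(2)] \<eta>(2) by simp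
    then show "x = y" using \<eta>(3) ract_unit[OF x] by simp
  qed
  then show thesis using that V by blast
qed

section \<open>Inner products of lifted functions\<close>

lemma infsum_single_support:
  fixes f :: "'a \<Rightarrow> complex"
  assumes "x \<in> A" "\<And>y. y \<in> A \<Longrightarrow> y \<noteq> x \<Longrightarrow> f y = 0"
  shows "infsum f A = f x"
proof -
  have "infsum f A = infsum f {x}"
    by (rule infsum_cong_neutral) (use assms in auto)
  then show ?thesis by simp
qed

definition lift :: "'z set \<Rightarrow> ('g \<Rightarrow> real) \<Rightarrow> 'z \<Rightarrow> complex" where
  "lift V f z = (if z \<in> V then of_real (f (r z)) else 0)"

text \<open>On \<open>V\<close> the anchor \<open>r\<close> is a homeomorphism onto an open subset of the Hausdorff unit space; it
  carries the Hausdorff property and the compact set \<open>C\<close> back to \<open>V\<close>.\<close>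

lemma lift_in_C_span:
  assumes V: "openin X V" and inj: "inj_on r V"
    and C: "compactin G0 C" "C \<subseteq> r ` V"
    and f: "continuous_map G0 euclidean f" "\<And>y. y \<in> topspace G0 - C \<Longrightarrow> f y = 0"
  shows "lift V f \<in> C_span X"
proof -
  let ?XV = "subtopology X V" and ?YV = "subtopology G0 (r ` V)"
  have VX: "V \<subseteq> topspace X" using V by (rule openin_subset)
  have rV: "r ` V \<subseteq> topspace G0" using VX r_in_units by blast
  have cont: "continuous_map ?XV G0 r"
    by (rule continuous_map_from_subtopology[OF r_continuous])
  have hom: "homeomorphic_map ?XV ?YV r"
  proof (rule bijective_open_imp_homeomorphic_map)
    show "continuous_map ?XV ?YV r"
      using cont by (simp add: continuous_map_in_subtopology image_subset_iff)
    show "open_map ?XV ?YV r"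
      unfolding open_map_def
    proof (intro allI impI)
      fix U assume "openin ?XV U"
      then have U: "openin X U" "U \<subseteq> V" using V by (auto simp: openin_open_subtopology)
      then have "openin G0 (r ` U)" using r_open by (simp add: open_map_def)
      moreover have "r ` U \<subseteq> r ` V" using U by blast
      ultimately show "openin ?YV (r ` U)" by (metis inf.absorb1 openin_subtopology)
    qed
    show "r ` topspace ?XV = topspace ?YV" using VX rV by (simp add: inf.absorb2)
    show "inj_on r (topspace ?XV)" using inj by (simp add: inj_on_def)
  qed
  define D where "D = {z \<in> V. r z \<in> C}"
  have "r ` D = C" using C(2) by (auto simp: D_def)
  then have "compactin ?YV (r ` D)" using C by (simp add: compactin_subtopology)
  moreover have "D \<subseteq> topspace ?XV" using VX by (auto simp: D_def)
  ultimately have "compactin ?XV D" using homeomorphic_map_compactness[OF hom] by blast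
  then have D: "compactin X D" "D \<subseteq> V" by (auto simp: compactin_subtopology)
  have haus: "Hausdorff_space ?XV"
    using homeomorphic_map_imp_homeomorphic_space[OF hom] G0_Hausdorff Hausdorff_space_subtopology
    by (metis homeomorphic_Hausdorff_space)
  have "continuous_map ?XV euclidean (\<lambda>z. complex_of_real (f (r z)))"
    using continuous_map_compose[OF continuous_map_compose[OF cont f(1)], of euclidean complex_of_real]
    by (simp add: o_def continuous_on_of_real)
  then have "continuous_map ?XV euclidean (lift V f)"
    by (rule continuous_map_eq) (simp add: lift_def)
  then have "lift V f \<in> C_c V X"
    by (rule C_cI[OF haus D]) (use f(2) VX r_in_units in \<open>auto simp: lift_def D_def\<close>)
  then show ?thesis by (rule C_c_imp_C_span[OF V haus])
qed

definition on_units :: "('g \<Rightarrow> complex) \<Rightarrow> 'g \<Rightarrow> complex" where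
  "on_units u \<gamma> = (if \<gamma> \<in> topspace G0 then u \<gamma> else 0)"

lemma inverse_range_source:
  assumes "\<gamma> \<in> arrows G"
  shows "ginv G \<gamma> \<in> arrows G" "src G (ginv G \<gamma>) = rng G \<gamma>" "rng G (ginv G \<gamma>) = src G \<gamma>"
    "rng G \<gamma> \<in> topspace G0" "src G \<gamma> \<in> topspace G0"
proof -
  show "ginv G \<gamma> \<in> arrows G" "src G (ginv G \<gamma>) = rng G \<gamma>" "rng G (ginv G \<gamma>) = src G \<gamma>"
    using alg(1) assms unfolding algebraic_groupoid_def by blast+
  show "rng G \<gamma> \<in> topspace G0" unfolding topspace_unit_space[OF alg(1)] using assms by blast
  have "src G \<gamma> \<in> arrows G" "rng G (src G \<gamma>) = src G \<gamma>"
    using alg(1) assms unfolding algebraic_groupoid_def by blast+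
  then show "src G \<gamma> \<in> topspace G0" unfolding topspace_unit_space[OF alg(1)] by (metis imageI)
qed

lemma unit_if_inverse_unit:
  assumes \<gamma>: "\<gamma> \<in> arrows G" and u: "ginv G \<gamma> \<in> topspace G0"
  shows "\<gamma> \<in> topspace G0"
proof -
  have "ginv G \<gamma> = rng G \<gamma>"
    using unit_laws(3)[OF alg(1) u] inverse_range_source(2)[OF \<gamma>] by simp
  moreover have "gmult G (ginv G \<gamma>) \<gamma> = src G \<gamma>" "gmult G (rng G \<gamma>) \<gamma> = \<gamma>"
    using alg(1) \<gamma> unfolding algebraic_groupoid_def by blast+
  ultimately show ?thesis using inverse_range_source(5)[OF \<gamma>] by simp
qed

text \<open>A nonzero term at \<open>\<gamma>\<close> is given by \<open>y = z\<eta> \<in> V\<close> with \<open>\<gamma>\<^sup>-\<^sup>1y \<in> V\<close>.  Both have the same image under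
  \<open>s\<close>, so they coincide and \<open>\<gamma>\<close> is the unit \<open>r(y)\<close>.  At a unit \<open>r(y)\<close> with \<open>y \<in> V\<close> the sum can be
  computed at \<open>y\<close> itself; any other \<open>y\<eta>\<close> has the same image under \<open>r\<close> as \<open>y\<close> and is therefore
  outside \<open>V\<close>.\<close>

lemma inner_lift:
  assumes V: "V \<subseteq> topspace X" and inj: "inj_on r V" "inj_on s V"
    and zero: "\<And>y. y \<in> topspace G0 - r ` V \<Longrightarrow> f y = 0"
  shows "inner_G G H Z (lift V f) (tilde (lift V f)) = on_units (\<lambda>y. of_real (f y * f y))"
proof
  fix \<gamma>
  let ?\<phi> = "lift V f"
  show "inner_G G H Z ?\<phi> (tilde ?\<phi>) \<gamma> = on_units (\<lambda>y. of_real (f y * f y)) \<gamma>"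
  proof (cases "\<gamma> \<in> arrows G")
    case False
    then show ?thesis using unit_laws(1)[OF alg(1)] by (auto simp: inner_G_def on_units_def)
  next
    case \<gamma>: True
    note inv = inverse_range_source[OF \<gamma>]
    \<comment> \<open>The base point stays free because the last case below takes it in \<open>V\<close>.\<close>
    have at: "inner_G G H Z ?\<phi> (tilde ?\<phi>) \<gamma> =
        infsum (\<lambda>\<eta>. ?\<phi> (ract Z z \<eta>) * ?\<phi> (lact Z (ginv G \<gamma>) (ract Z z \<eta>)))
          {\<eta> \<in> arrows H. rng H \<eta> = s z}" if z: "z \<in> topspace X" "r z = rng G \<gamma>" for z
    proof -
      define w where "w = (SOME z. z \<in> topspace X \<and> r z = rng G \<gamma>)"
      have w: "w \<in> topspace X \<and> r w = rng G \<gamma>" unfolding w_def by (rule someI) (use z in blast)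
      have "inner_G G H Z ?\<phi> (tilde ?\<phi>) \<gamma> = inner_at G H Z ?\<phi> (tilde ?\<phi>) \<gamma> w"
        using \<gamma> by (simp add: inner_G_def w_def)
      also have "\<dots> = inner_at G H Z ?\<phi> (tilde ?\<phi>) \<gamma> z"
        by (rule inner_at_independent[OF alg(2) equivalence]) (use w z in auto)
      finally show ?thesis by (simp add: inner_at_def tilde_def)
    qed
    obtain z where z: "z \<in> topspace X" "r z = rng G \<gamma>" using r_surjective[OF inv(4)] by blast
    show ?thesis
    proof (cases "\<gamma> \<in> topspace G0 \<and> \<gamma> \<in> r ` V")
      case False
      have "?\<phi> (ract Z z \<eta>) * ?\<phi> (lact Z (ginv G \<gamma>) (ract Z z \<eta>)) = 0"
        if \<eta>: "\<eta> \<in> arrows H" "rng H \<eta> = s z" for \<eta>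
      proof (rule ccontr)
        let ?y = "ract Z z \<eta>"
        assume "?\<phi> ?y * ?\<phi> (lact Z (ginv G \<gamma>) ?y) \<noteq> 0"
        then have yV: "?y \<in> V" "lact Z (ginv G \<gamma>) ?y \<in> V" by (auto simp: lift_def split: if_splits)
        have y: "?y \<in> topspace X" "r ?y = rng G \<gamma>"
          using ract_in_space[of \<eta> z] r_ract[of \<eta> z] \<eta> z by simp_all
        have src: "src G (ginv G \<gamma>) = r ?y" using inv(2) y(2) by simp
        have "s (lact Z (ginv G \<gamma>) ?y) = s ?y"
          by (rule s_lact[OF inv(1) y(1) src])
        then have "lact Z (ginv G \<gamma>) ?y = ?y" by (rule inj_onD[OF inj(2) _ yV(2,1)])
        then have "ginv G \<gamma> = r ?y" by (rule lact_free[OF inv(1) y(1) src])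
        then have "\<gamma> \<in> topspace G0" using unit_if_inverse_unit[OF \<gamma>] y(2) inv(4) by simp
        moreover from this have "\<gamma> = r ?y" using unit_laws(2)[OF alg(1)] y(2) by simp
        ultimately show False using False yV by blast
      qed
      then have "inner_G G H Z ?\<phi> (tilde ?\<phi>) \<gamma> = 0"
        unfolding at[OF z] by (intro infsum_0) auto
      moreover have "on_units (\<lambda>y. of_real (f y * f y)) \<gamma> = 0"
        using False zero by (auto simp: on_units_def)
      ultimately show ?thesis by simp
    next
      case True
      then obtain y where y: "y \<in> V" "\<gamma> = r y" and u: "\<gamma> \<in> topspace G0" by blast
      note ul = unit_laws[OF alg(1) u]
      have yX: "y \<in> topspace X" using y V by blast
      have ry: "r y = rng G \<gamma>" using ul(2) y(2) by simp
      have yu: "s y \<in> {\<eta> \<in> arrows H. rng H \<eta> = s y}"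
        using unit_laws[OF alg(2) s_in_units[OF yX]] by simp
      have "inner_G G H Z ?\<phi> (tilde ?\<phi>) \<gamma> =
          ?\<phi> (ract Z y (s y)) * ?\<phi> (lact Z (ginv G \<gamma>) (ract Z y (s y)))"
        unfolding at[OF yX ry]
      proof (rule infsum_single_support[OF yu])
        fix \<eta> assume \<eta>: "\<eta> \<in> {\<eta> \<in> arrows H. rng H \<eta> = s y}" "\<eta> \<noteq> s y"
        have "ract Z y \<eta> \<notin> V"
        proof
          assume "ract Z y \<eta> \<in> V"
          moreover have "r (ract Z y \<eta>) = r y" using r_ract \<eta> yX by simp
          ultimately have "ract Z y \<eta> = y" using inj_onD[OF inj(1)] y by blast
          then have "\<eta> = s y" using \<eta>(1) by (intro ract_free[OF _ yX]) simp_all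
          then show False using \<eta>(2) by simp
        qed
        then show "?\<phi> (ract Z y \<eta>) * ?\<phi> (lact Z (ginv G \<gamma>) (ract Z y \<eta>)) = 0"
          by (simp add: lift_def)
      qed
      then show ?thesis
        using y u ul by (simp add: ract_unit[OF yX] lact_unit[OF yX] lift_def on_units_def)
    qed
  qed
qed

section \<open>Functions on the units as multipliers\<close>

lemma nonunit_in_fibre:
  assumes "\<gamma> \<in> {\<gamma> \<in> arrows G. rng G \<gamma> = r z}" "\<gamma> \<noteq> r z"
  shows "\<gamma> \<notin> topspace G0" "ginv G \<gamma> \<notin> topspace G0"
proof -
  show *: "\<gamma> \<notin> topspace G0" using assms unit_laws(2)[OF alg(1)] by auto
  then show "ginv G \<gamma> \<notin> topspace G0" using assms unit_if_inverse_unit by blast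
qed

text \<open>The only unit in the fibre of arrows with range \<open>r z\<close> is \<open>r z\<close> itself.\<close>

lemma left_mod_on_units:
  assumes z: "z \<in> topspace X"
  shows "left_mod G Z (on_units u) \<phi> z = u (r z) * \<phi> z"
proof -
  note ul = unit_laws[OF alg(1) r_in_units[OF z]]
  have "left_mod G Z (on_units u) \<phi> z =
      on_units u (r z) * \<phi> (lact Z (ginv G (r z)) z)"
    unfolding left_mod_def if_P[OF z]
    by (rule infsum_single_support)
       (use ul nonunit_in_fibre in \<open>simp_all add: on_units_def\<close>)
  then show ?thesis using ul r_in_units[OF z] by (simp add: on_units_def lact_unit[OF z])
qed

lemma right_mod_on_units:
  assumes z: "z \<in> topspace X"
  shows "right_mod G Z \<psi> (on_units u) (bar z) = u (r z) * \<psi> (bar z)"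
proof -
  note ul = unit_laws[OF alg(1) r_in_units[OF z]]
  have "right_mod G Z \<psi> (on_units u) (bar z) =
      \<psi> (bar (lact Z (ginv G (r z)) z)) * on_units u (ginv G (r z))"
    unfolding right_mod_def opp.sel if_P[OF z]
    by (rule infsum_single_support)
       (use ul nonunit_in_fibre in \<open>simp_all add: on_units_def\<close>)
  then show ?thesis using ul r_in_units[OF z] by (simp add: on_units_def lact_unit[OF z])
qed

section \<open>Local units and the approximate identity\<close>

lemma bisection_cover:
  assumes "x \<in> topspace G0"
  obtains V where "openin X V" "inj_on r V" "inj_on s V" "x \<in> r ` V"
proof -
  obtain z where z: "z \<in> topspace X" "r z = x" using r_surjective[OF assms] by blast
  obtain V W where VW: "openin X V" "z \<in> V" "inj_on r V" "openin X W" "z \<in> W" "inj_on s W"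
    using r_locally_injective[OF z(1)] s_locally_injective[OF z(1)] by metis
  show thesis
  proof
    show "openin X (V \<inter> W)" using VW by (intro openin_Int)
    show "inj_on r (V \<inter> W)" "inj_on s (V \<inter> W)" using VW(3,6) by (auto simp: inj_on_def)
    show "x \<in> r ` (V \<inter> W)" using VW z by blast
  qed
qed

lemma on_units_in_C_span:
  assumes u: "continuous_map G0 euclidean u" and C: "compactin G0 C"
    and zero: "\<And>y. y \<in> topspace G0 - C \<Longrightarrow> u y = 0"
  shows "on_units u \<in> C_span (gtop G)"
proof -
  note op = openin_unit_space[OF alg(1) G(2)]
  have top: "subtopology (gtop G) (topspace G0) = G0"
    using topspace_unit_space[OF alg(1)] by (simp add: unit_space_def)
  have CG: "compactin (gtop G) C" "C \<subseteq> topspace G0"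
    using C compactin_subtopology[of "gtop G" "topspace G0" C] unfolding top by simp_all
  have "on_units u \<in> C_c (topspace G0) (gtop G)"
  proof (rule C_cI[OF _ CG])
    show "Hausdorff_space (subtopology (gtop G) (topspace G0))"
      unfolding top by (rule G0_Hausdorff)
    show "continuous_map (subtopology (gtop G) (topspace G0)) euclidean (on_units u)"
      unfolding top by (rule continuous_map_eq[OF u]) (simp add: on_units_def)
    show "on_units u x = 0" if "x \<notin> C" for x
      using that zero by (simp add: on_units_def)
  qed
  then show ?thesis
    by (rule C_c_imp_C_span[OF op, rotated]) (simp add: top G0_Hausdorff)
qed

text \<open>The functions \<open>\<phi> i\<close> are the lifts to \<open>Z\<close> of a partition of unity by squares subordinate to the
  images under \<open>r\<close> of the open sets on which both anchors are injective.\<close>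

lemma local_unit:
  assumes K: "compactin G0 K"
  obtains u n \<phi> where "continuous_map G0 euclidean u" "\<And>x. x \<in> K \<Longrightarrow> u x = 1"
    "on_units u \<in> C_span (gtop G)" "\<And>i. i < (n::nat) \<Longrightarrow> \<phi> i \<in> C_span X"
    "on_units u = (\<lambda>\<gamma>. \<Sum>i<n. inner_G G H Z (\<phi> i) (tilde (\<phi> i)) \<gamma>)"
proof -
  define \<U> where "\<U> = {r ` V | V. openin X V \<and> inj_on r V \<and> inj_on s V}"
  have open_U: "openin G0 U" if "U \<in> \<U>" for U
    using that r_open by (auto simp: \<U>_def open_map_def)
  have cover: "K \<subseteq> \<Union>\<U>"
  proof
    fix x assume "x \<in> K"
    then have "x \<in> topspace G0" using compactin_subset_topspace[OF K] by blast
    then obtain V where "openin X V" "inj_on r V" "inj_on s V" "x \<in> r ` V"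
      by (rule bisection_cover)
    then show "x \<in> \<Union>\<U>" unfolding \<U>_def by blast
  qed
  obtain n :: nat and U C and f :: "nat \<Rightarrow> 'g \<Rightarrow> real" where
    U: "\<forall>i<n. U i \<in> \<U> \<and> compactin G0 (C i) \<and> C i \<subseteq> U i"
    and f_prop: "\<forall>i<n. continuous_map G0 euclidean (f i) \<and> (\<forall>y \<in> topspace G0 - C i. f i y = 0)"
    and f_sum: "\<forall>y\<in>K. (\<Sum>i<n. f i y * f i y) = 1"
    by (rule square_partition_of_unity[OF G0_lc G0_Hausdorff _ K cover]) (erule open_U, rule that)
  have UC: "U i \<in> \<U> \<and> compactin G0 (C i) \<and> C i \<subseteq> U i"
    and f: "continuous_map G0 euclidean (f i)"
    and f0: "y \<in> topspace G0 - C i \<Longrightarrow> f i y = 0" if "i < n" for i y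
    using U f_prop that by blast+
  have f1: "(\<Sum>i<n. f i y * f i y) = 1" if "y \<in> K" for y
    using f_sum that by blast
  have "\<exists>V. U i = r ` V \<and> openin X V \<and> inj_on r V \<and> inj_on s V" if "i < n" for i
    using UC[OF that] unfolding \<U>_def by blast
  then obtain V where V: "\<And>i. i < n \<Longrightarrow>
      U i = r ` V i \<and> openin X (V i) \<and> inj_on r (V i) \<and> inj_on s (V i)"
    by metis
  define u where "u y = complex_of_real (\<Sum>i<n. f i y * f i y)" for y
  have cont: "continuous_map G0 euclidean (\<lambda>y. \<Sum>i<n. f i y * f i y)"
    by (intro continuous_intros f) auto
  show thesis
  proof
    show u: "continuous_map G0 euclidean u"
      using continuous_map_compose[OF cont, of euclidean complex_of_real]
      unfolding u_def by (simp add: o_def continuous_on_of_real)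
    show "u x = 1" if "x \<in> K" for x unfolding u_def f1[OF that] by simp
    show "on_units u \<in> C_span (gtop G)"
    proof (rule on_units_in_C_span[OF u])
      show "compactin G0 (\<Union>i<n. C i)" by (rule compactin_Union) (use UC in auto)
      show "u y = 0" if "y \<in> topspace G0 - (\<Union>i<n. C i)" for y
        using that f0 unfolding u_def by simp
    qed
    show "lift (V i) (f i) \<in> C_span X" if i: "i < n" for i
      by (rule lift_in_C_span[of _ "C i"]) (use V[OF i] UC[OF i] f[OF i] f0[OF i] in auto)
    have "inner_G G H Z (lift (V i) (f i)) (tilde (lift (V i) (f i))) \<gamma> =
        on_units (\<lambda>y. of_real (f i y * f i y)) \<gamma>" if i: "i < n" for i \<gamma>
    proof -
      have "V i \<subseteq> topspace X" using V[OF i] openin_subset by blast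
      moreover have "f i y = 0" if "y \<in> topspace G0 - r ` V i" for y
        using UC[OF i] V[OF i] that by (intro f0[OF i]) blast
      ultimately show ?thesis using V[OF i] by (subst inner_lift) blast+
    qed
    then show "on_units u =
        (\<lambda>\<gamma>. \<Sum>i<n. inner_G G H Z (lift (V i) (f i)) (tilde (lift (V i) (f i))) \<gamma>)"
      by (simp add: fun_eq_iff on_units_def u_def)
  qed
qed

text \<open>The net is eventually constant: if \<open>\<phi>\<close> vanishes off the compact set \<open>K\<close>, then every index
  containing the compact set \<open>r ` K\<close> fixes \<open>\<phi>\<close>.\<close>

lemma left_mod_converges:
  assumes u: "\<And>K. compactin G0 K \<Longrightarrow> continuous_map G0 euclidean (u K)"
    and one: "\<And>K x. compactin G0 K \<Longrightarrow> x \<in> K \<Longrightarrow> u K x = 1"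
    and \<phi>: "\<phi> \<in> C_span X"
  shows "inductive_limit_converges X {K. compactin G0 K} (\<subseteq>)
           (\<lambda>K. left_mod G Z (on_units (u K)) \<phi>) \<phi>"
proof -
  obtain K where K: "compactin X K" "\<And>z. z \<notin> K \<Longrightarrow> \<phi> z = 0"
    using C_span_compact_support[OF \<phi>] by metis
  have KX: "K \<subseteq> topspace X" using K(1) by (rule compactin_subset_topspace)
  have rK: "compactin G0 (r ` K)" by (rule image_compactin[OF K(1) r_continuous])
  have prod: "left_mod G Z (on_units a) \<phi> = (\<lambda>z. a (r z) * \<phi> z)" for a
  proof
    fix z
    show "left_mod G Z (on_units a) \<phi> z = a (r z) * \<phi> z"
    proof (cases "z \<in> topspace X")
      case False
      then have "\<phi> z = 0" using K(2) KX by blast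
      then show ?thesis using False by (simp add: left_mod_def)
    qed (rule left_mod_on_units)
  qed
  have eq: "left_mod G Z (on_units (u L)) \<phi> = \<phi>" if "compactin G0 L" "r ` K \<subseteq> L" for L
  proof
    fix z
    show "left_mod G Z (on_units (u L)) \<phi> z = \<phi> z"
      unfolding prod using one[OF that(1)] that(2) K(2)[of z] by (cases "z \<in> K") auto
  qed
  show ?thesis
    unfolding inductive_limit_converges_def
  proof (intro conjI ballI allI impI)
    show "left_mod G Z (on_units (u L)) \<phi> \<in> C_span X" if "L \<in> {K. compactin G0 K}" for L
      using C_span_mult[OF \<phi> continuous_map_compose[OF r_continuous u]] that
      by (simp add: prod o_def)
    show "\<exists>K. compactin X K \<and> (\<exists>L\<^sub>0\<in>{K. compactin G0 K}. \<forall>L\<in>{K. compactin G0 K}.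
        L\<^sub>0 \<subseteq> L \<longrightarrow> (\<forall>z. z \<notin> K \<longrightarrow> left_mod G Z (on_units (u L)) \<phi> z = 0))"
      by (rule exI[of _ K], intro conjI K(1) bexI[of _ "r ` K"]) (use K(2) rK eq in auto)
    show "\<exists>L\<^sub>1\<in>{K. compactin G0 K}. \<forall>L\<in>{K. compactin G0 K}. L\<^sub>1 \<subseteq> L \<longrightarrow>
        (\<forall>z\<in>topspace X. cmod (left_mod G Z (on_units (u L)) \<phi> z - \<phi> z) < \<epsilon>)"
      if "0 < \<epsilon>" for \<epsilon>
      by (rule bexI[of _ "r ` K"]) (use rK eq that in auto)
  qed (rule \<phi>)
qed

lemma right_mod_converges:
  assumes u: "\<And>K. compactin G0 K \<Longrightarrow> continuous_map G0 euclidean (u K)"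
    and one: "\<And>K x. compactin G0 K \<Longrightarrow> x \<in> K \<Longrightarrow> u K x = 1"
    and \<psi>: "\<psi> \<in> C_span (opp_top X)"
  shows "inductive_limit_converges (opp_top X) {K. compactin G0 K} (\<subseteq>)
           (\<lambda>K. right_mod G Z \<psi> (on_units (u K))) \<psi>"
proof -
  have cr: "continuous_map (opp_top X) G0 (r \<circ> unbar)"
    unfolding opp_top_def by (rule continuous_map_pullback[OF r_continuous])
  have top: "w \<in> topspace (opp_top X) \<longleftrightarrow> unbar w \<in> topspace X" for w
    by (simp add: opp_top_def topspace_pullback_topology)
  obtain K where K: "compactin (opp_top X) K" "\<And>w. w \<notin> K \<Longrightarrow> \<psi> w = 0"
    using C_span_compact_support[OF \<psi>] by metis
  have KX: "K \<subseteq> topspace (opp_top X)" using K(1) by (rule compactin_subset_topspace)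
  have rK: "compactin G0 ((r \<circ> unbar) ` K)" by (rule image_compactin[OF K(1) cr])
  have prod: "right_mod G Z \<psi> (on_units a) = (\<lambda>w. a (r (unbar w)) * \<psi> w)" for a
  proof
    fix w
    show "right_mod G Z \<psi> (on_units a) w = a (r (unbar w)) * \<psi> w"
    proof (cases "unbar w \<in> topspace X")
      case True
      then show ?thesis using right_mod_on_units[of "unbar w"] by simp
    next
      case False
      then have "\<psi> w = 0" using K(2) KX top by blast
      then show ?thesis using False by (simp add: right_mod_def)
    qed
  qed
  have eq: "right_mod G Z \<psi> (on_units (u L)) = \<psi>"
    if "compactin G0 L" "(r \<circ> unbar) ` K \<subseteq> L" for L
  proof
    fix w
    show "right_mod G Z \<psi> (on_units (u L)) w = \<psi> w"
      unfolding prod using one[OF that(1)] that(2) K(2)[of w] by (cases "w \<in> K") auto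
  qed
  show ?thesis
    unfolding inductive_limit_converges_def
  proof (intro conjI ballI allI impI)
    show "right_mod G Z \<psi> (on_units (u L)) \<in> C_span (opp_top X)"
      if "L \<in> {K. compactin G0 K}" for L
      using C_span_mult[OF \<psi> continuous_map_compose[OF cr u]] that
      by (simp add: prod o_def)
    show "\<exists>K. compactin (opp_top X) K \<and> (\<exists>L\<^sub>0\<in>{K. compactin G0 K}. \<forall>L\<in>{K. compactin G0 K}.
        L\<^sub>0 \<subseteq> L \<longrightarrow> (\<forall>w. w \<notin> K \<longrightarrow> right_mod G Z \<psi> (on_units (u L)) w = 0))"
      by (rule exI[of _ K], intro conjI K(1) bexI[of _ "(r \<circ> unbar) ` K"]) (use K(2) rK eq in auto)
    show "\<exists>L\<^sub>1\<in>{K. compactin G0 K}. \<forall>L\<in>{K. compactin G0 K}. L\<^sub>1 \<subseteq> L \<longrightarrow>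
        (\<forall>w\<in>topspace (opp_top X). cmod (right_mod G Z \<psi> (on_units (u L)) w - \<psi> w) < \<epsilon>)"
      if "0 < \<epsilon>" for \<epsilon>
      by (rule bexI[of _ "(r \<circ> unbar) ` K"]) (use rK eq that in auto)
  qed (rule \<psi>)
qed

end

theorem proposition4p8:
  fixes G :: "'g groupoid" and H :: "'h groupoid" and Z :: "('g, 'h, 'z) bispace"
  assumes "lc_lH_groupoid G" and "etale G"
    and "lc_lH_groupoid H" and "etale H"
    and "paracompact_space (unit_space G)"
    and "groupoid_equivalence G H Z"
  shows "\<exists>(\<Lambda> :: (('g \<Rightarrow> complex) \<times> ('g \<Rightarrow> complex) set) set) le e.
     directed_set \<Lambda> le \<and>
     (\<forall>l\<in>\<Lambda>. e l \<in> C_span (gtop G)) \<and>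
     (\<forall>\<phi>\<in>C_span (ztop Z).
        inductive_limit_converges (ztop Z) \<Lambda> le (\<lambda>l. left_mod G Z (e l) \<phi>) \<phi>) \<and>
     (\<forall>\<psi>\<in>C_span (opp_top (ztop Z)).
        inductive_limit_converges (opp_top (ztop Z)) \<Lambda> le (\<lambda>l. right_mod G Z \<psi> (e l)) \<psi>) \<and>
     (\<forall>l\<in>\<Lambda>. \<exists>(n::nat) \<phi>. (\<forall>i<n. \<phi> i \<in> C_span (ztop Z)) \<and>
        e l = (\<lambda>\<gamma>. \<Sum>i<n. inner_G G H Z (\<phi> i) (tilde (\<phi> i)) \<gamma>))"
proof -
  interpret etale_equivalence G H Z
    using assms by unfold_locales
  define good where "good K u \<longleftrightarrow> continuous_map G0 euclidean u \<and> (\<forall>x\<in>K. u x = 1) \<and>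
      on_units u \<in> C_span (gtop G) \<and>
      (\<exists>(n::nat) \<phi>. (\<forall>i<n. \<phi> i \<in> C_span X) \<and>
        on_units u = (\<lambda>\<gamma>. \<Sum>i<n. inner_G G H Z (\<phi> i) (tilde (\<phi> i)) \<gamma>))" for K u
  have "\<exists>u. good K u" if K: "compactin G0 K" for K
    by (rule local_unit[OF K]) (use good_def in blast)
  then obtain u where u: "\<And>K. compactin G0 K \<Longrightarrow> good K (u K)" by metis
  define \<Lambda> where "\<Lambda> = {K. compactin G0 K}"
  have d: "directed_set \<Lambda> (\<subseteq>)"
    unfolding directed_set_def
  proof (intro conjI ballI)
    show "\<Lambda> \<noteq> {}" using compactin_empty[of G0] by (auto simp: \<Lambda>_def)
    show "reflp_on \<Lambda> (\<subseteq>)" by (rule reflp_onI) simp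
    show "transp_on \<Lambda> (\<subseteq>)" by (rule transp_onI) (rule subset_trans)
    show "\<exists>M\<in>\<Lambda>. K \<subseteq> M \<and> L \<subseteq> M" if "K \<in> \<Lambda>" "L \<in> \<Lambda>" for K L
      using that compactin_Un[of G0 K L] by (intro bexI[of _ "K \<union> L"]) (auto simp: \<Lambda>_def)
  qed
  \<comment> \<open>Compact sets are the natural indices; the required index type is reached by passing to pairs
    of a value of the net and its tail of values.\<close>
  note net = net_reindexing[OF d, where e = "\<lambda>K. on_units (u K)"]
  let ?\<Lambda> = "(\<lambda>K. (on_units (u K), (\<lambda>K. on_units (u K)) ` {L \<in> \<Lambda>. K \<subseteq> L})) ` \<Lambda>"
  let ?le = "\<lambda>p q :: ('g \<Rightarrow> complex) \<times> ('g \<Rightarrow> complex) set. snd q \<subseteq> snd p"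
  have cont: "continuous_map G0 euclidean (u K)" and one: "x \<in> K \<Longrightarrow> u K x = 1"
    if "compactin G0 K" for K x
    using u[OF that] by (auto simp: good_def)
  have val: "\<exists>K. compactin G0 K \<and> fst l = on_units (u K)" if "l \<in> ?\<Lambda>" for l
    using that by (auto simp: \<Lambda>_def)
  show ?thesis
  proof (intro exI[of _ ?\<Lambda>] exI[of _ ?le] exI[of _ fst] conjI ballI)
    show "directed_set ?\<Lambda> ?le" by (rule net(1))
    show "fst l \<in> C_span (gtop G)" if "l \<in> ?\<Lambda>" for l
      using val[OF that] u by (auto simp: good_def)
    show "inductive_limit_converges X ?\<Lambda> ?le (\<lambda>l. left_mod G Z (fst l) \<phi>) \<phi>"
      if "\<phi> \<in> C_span X" for \<phi>
      by (rule net(3)[where X = X and F = "\<lambda>a. left_mod G Z a \<phi>"])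
         (unfold \<Lambda>_def, rule left_mod_converges[OF cont one that])
    show "inductive_limit_converges (opp_top X) ?\<Lambda> ?le (\<lambda>l. right_mod G Z \<psi> (fst l)) \<psi>"
      if "\<psi> \<in> C_span (opp_top X)" for \<psi>
      by (rule net(3)[where X = "opp_top X" and F = "\<lambda>a. right_mod G Z \<psi> a"])
         (unfold \<Lambda>_def, rule right_mod_converges[OF cont one that])
    show "\<exists>(n::nat) \<phi>. (\<forall>i<n. \<phi> i \<in> C_span X) \<and>
        fst l = (\<lambda>\<gamma>. \<Sum>i<n. inner_G G H Z (\<phi> i) (tilde (\<phi> i)) \<gamma>)" if "l \<in> ?\<Lambda>" for l
      using val[OF that] u unfolding good_def by metis
  qed
qed

end
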